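(* A conventional cylindrical closed Cartan ribbon (without vertices) and a Möbius strip Cartan ribbon both contribute zero to the total curvature integral. That is, if $\mathcal{B}$ is such a ribbon, then $$\int_{\mathcal{B}}K\,d\mu+\int_{\partial\mathcal{B}}\kappa_g\,ds+\sum_j\alpha_j=0,$$ where $K$ is the Gaussian curvature, $\kappa_g$ is the geodesic curvature of the edges of $\mathcal{B}$ (away from kinks), and $\alpha_j\in[-\pi,\pi]$ are the outer angles at the kinks, if any, of the edges.
   Context: A Cartan surface ribbon along a smooth regular curve $\gamma$ on a surface $S\subset\mathbb{R}^3$ with nowhere vanishing normal curvature is the regular, intrinsically flat ($K=0$) ruled surface $r(t,u)=\gamma(t)+u\,\beta(t)$, $-w_-(t)\le u\le w_+(t)$, where $\beta=(\kappa_n h-\tau_g e)/\sqrt{\kappa_n^2+\tau_g^2}$, with $\{e=\gamma'/\|\gamma'\|,\ h=N\times e,\ N\}$ the Darboux frame of $\gamma$ on $S$ ($N$ a unit normal of $S$), $\kappa_n$ the normal curvature and $\tau_g$ the geodesic torsion of $\gamma$, and $w_\pm>0$ (piecewise smooth) width functions. The ribbon is closed if its center curve is a closed smooth curve on $S$; it is then either cylindrical (an annulus with two edge curves) or a Möbius strip (with one edge curve). The edges are the curves $u=-w_-$ and $u=w_+$, and their geodesic curvature and outer angles are taken with the sign convention of the Gauss–Bonnet theorem, i.e. with respect to the inward conormal. The outer angle at a kink is $\alpha=\pi-\beta_0$, with $\beta_0\in[0,2\pi]$ the interior angle of the ribbon there. *)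

theory Defs
  imports "HOL-Analysis.Analysis"
begin

section \<open>Smooth maps, surfaces and tangent vectors\<close>

text \<open>On an open set of a Euclidean space, \<open>Ck_on k U f\<close> says that all iterated directional
  derivatives of order at most \<open>k\<close> exist and are continuous.\<close>

fun Ck_on :: "nat \<Rightarrow> 'a::euclidean_space set \<Rightarrow> ('a \<Rightarrow> 'b::real_normed_vector) \<Rightarrow> bool" where
  "Ck_on 0 U f \<longleftrightarrow> continuous_on U f"
| "Ck_on (Suc k) U f \<longleftrightarrow>
     (\<forall>x\<in>U. f differentiable (at x)) \<and> (\<forall>v. Ck_on k U (\<lambda>x. frechet_derivative f (at x) v))"

definition smooth_on :: "'a::euclidean_space set \<Rightarrow> ('a \<Rightarrow> 'b::real_normed_vector) \<Rightarrow> bool" where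
  "smooth_on U f \<longleftrightarrow> (\<forall>k. Ck_on k U f)"

text \<open>Regular surfaces in space, as local regular level sets.\<close>

definition smooth_surface :: "(real^3) set \<Rightarrow> bool" where
  "smooth_surface S \<longleftrightarrow>
     (\<forall>p\<in>S. \<exists>U (f :: real^3 \<Rightarrow> real). open U \<and> p \<in> U \<and> smooth_on U f \<and>
        (\<forall>x\<in>U. \<exists>v. frechet_derivative f (at x) v \<noteq> 0) \<and> S \<inter> U = {x \<in> U. f x = 0})"

definition tangent_space :: "(real^3) set \<Rightarrow> real^3 \<Rightarrow> (real^3) set" where
  "tangent_space S p =
     {v. \<exists>c. \<exists>e>0. smooth_on {-e<..<e} c \<and> (\<forall>s\<in>{-e<..<e}. c s \<in> S) \<and> c 0 = p \<and>
           (c has_vector_derivative v) (at (0::real))}"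

text \<open>The pieces are closed intervals on which \<open>w\<close> agrees with a smooth function, so one-sided
  derivatives of all orders are finite; the values of two adjacent pieces at the common endpoint
  coincide, so \<open>w\<close> is continuous.\<close>

definition piecewise_smooth :: "(real \<Rightarrow> real) \<Rightarrow> bool" where
  "piecewise_smooth w \<longleftrightarrow>
     (\<exists>P. (\<forall>a b. finite (P \<inter> {a..b})) \<and>
          (\<forall>a b. a < b \<and> P \<inter> {a<..<b} = {} \<longrightarrow>
             (\<exists>g. smooth_on UNIV g \<and> (\<forall>t\<in>{a..b}. w t = g t))))"


section \<open>The Darboux frame\<close>

abbreviation velocity :: "(real \<Rightarrow> real^3) \<Rightarrow> real \<Rightarrow> real^3" where
  "velocity c t \<equiv> vector_derivative c (at t)"

definition unit_tangent :: "(real \<Rightarrow> real^3) \<Rightarrow> real \<Rightarrow> real^3" where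
  "unit_tangent c t = velocity c t /\<^sub>R norm (velocity c t)"

definition darboux_h :: "(real \<Rightarrow> real^3) \<Rightarrow> (real \<Rightarrow> real^3) \<Rightarrow> real \<Rightarrow> real^3" where
  "darboux_h \<gamma> N t = cross3 (N t) (unit_tangent \<gamma> t)"

text \<open>With \<open>s\<close> the arc length, \<open>de/ds = \<kappa>\<^sub>g h + \<kappa>\<^sub>n N\<close>, \<open>dh/ds = -\<kappa>\<^sub>g e + \<tau>\<^sub>g N\<close>,
  \<open>dN/ds = -\<kappa>\<^sub>n e - \<tau>\<^sub>g h\<close>.\<close>

definition normal_curvature :: "(real \<Rightarrow> real^3) \<Rightarrow> (real \<Rightarrow> real^3) \<Rightarrow> real \<Rightarrow> real" where
  "normal_curvature \<gamma> N t =
     (vector_derivative (unit_tangent \<gamma>) (at t) \<bullet> N t) / norm (velocity \<gamma> t)"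

definition geodesic_torsion :: "(real \<Rightarrow> real^3) \<Rightarrow> (real \<Rightarrow> real^3) \<Rightarrow> real \<Rightarrow> real" where
  "geodesic_torsion \<gamma> N t =
     (vector_derivative (darboux_h \<gamma> N) (at t) \<bullet> N t) / norm (velocity \<gamma> t)"

definition director_numerator :: "(real \<Rightarrow> real^3) \<Rightarrow> (real \<Rightarrow> real^3) \<Rightarrow> real \<Rightarrow> real^3" where
  "director_numerator \<gamma> N t =
     normal_curvature \<gamma> N t *\<^sub>R darboux_h \<gamma> N t - geodesic_torsion \<gamma> N t *\<^sub>R unit_tangent \<gamma> t"

definition director_denominator :: "(real \<Rightarrow> real^3) \<Rightarrow> (real \<Rightarrow> real^3) \<Rightarrow> real \<Rightarrow> real" where
  "director_denominator \<gamma> N t = sqrt ((normal_curvature \<gamma> N t)\<^sup>2 + (geodesic_torsion \<gamma> N t)\<^sup>2)"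

definition cartan_director :: "(real \<Rightarrow> real^3) \<Rightarrow> (real \<Rightarrow> real^3) \<Rightarrow> real \<Rightarrow> real^3" where
  "cartan_director \<gamma> N t = director_numerator \<gamma> N t /\<^sub>R director_denominator \<gamma> N t"


section \<open>Parametrized surfaces\<close>

definition par1 :: "(real \<Rightarrow> real \<Rightarrow> real^3) \<Rightarrow> real \<Rightarrow> real \<Rightarrow> real^3" where
  "par1 r t u = vector_derivative (\<lambda>s. r s u) (at t)"

definition par2 :: "(real \<Rightarrow> real \<Rightarrow> real^3) \<Rightarrow> real \<Rightarrow> real \<Rightarrow> real^3" where
  "par2 r t u = vector_derivative (\<lambda>v. r t v) (at u)"

definition area_density :: "(real \<Rightarrow> real \<Rightarrow> real^3) \<Rightarrow> real \<Rightarrow> real \<Rightarrow> real" where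
  "area_density r t u = norm (cross3 (par1 r t u) (par2 r t u))"

definition gauss_curvature :: "(real \<Rightarrow> real \<Rightarrow> real^3) \<Rightarrow> real \<Rightarrow> real \<Rightarrow> real" where
  "gauss_curvature r t u =
     (let rt = par1 r t u; ru = par2 r t u;
          n = cross3 rt ru /\<^sub>R norm (cross3 rt ru);
          L = par1 (par1 r) t u \<bullet> n; M = par2 (par1 r) t u \<bullet> n; Q = par2 (par2 r) t u \<bullet> n
      in (L * Q - M\<^sup>2) / ((rt \<bullet> rt) * (ru \<bullet> ru) - (rt \<bullet> ru)\<^sup>2))"


section \<open>Cartan ribbons\<close>

definition ruled :: "(real \<Rightarrow> real^3) \<Rightarrow> (real \<Rightarrow> real^3) \<Rightarrow> real \<Rightarrow> real \<Rightarrow> real^3" where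
  "ruled \<gamma> \<beta> t u = \<gamma> t + u *\<^sub>R \<beta> t"

definition regular_curve_on ::
  "(real^3) set \<Rightarrow> (real \<Rightarrow> real^3) \<Rightarrow> (real \<Rightarrow> real^3) \<Rightarrow> bool" where
  "regular_curve_on S \<gamma> N \<longleftrightarrow>
     smooth_surface S \<and>
     smooth_on UNIV \<gamma> \<and> (\<forall>t. \<gamma> t \<in> S) \<and> (\<forall>t. velocity \<gamma> t \<noteq> 0) \<and>
     smooth_on UNIV N \<and> (\<forall>t. norm (N t) = 1) \<and> (\<forall>t. \<forall>v\<in>tangent_space S (\<gamma> t). N t \<bullet> v = 0)"

definition regular_ribbon ::
  "(real \<Rightarrow> real^3) \<Rightarrow> (real \<Rightarrow> real^3) \<Rightarrow> (real \<Rightarrow> real) \<Rightarrow> (real \<Rightarrow> real) \<Rightarrow> bool" where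
  "regular_ribbon \<gamma> \<beta> wm wp \<longleftrightarrow>
     piecewise_smooth wm \<and> piecewise_smooth wp \<and> (\<forall>t. wm t > 0) \<and> (\<forall>t. wp t > 0) \<and>
     (\<forall>t. \<forall>u\<in>{- wm t..wp t}. cross3 (par1 (ruled \<gamma> \<beta>) t u) (par2 (ruled \<gamma> \<beta>) t u) \<noteq> 0)"

definition cartan_ribbon ::
  "(real^3) set \<Rightarrow> (real \<Rightarrow> real^3) \<Rightarrow> (real \<Rightarrow> real^3) \<Rightarrow> (real \<Rightarrow> real^3) \<Rightarrow>
   (real \<Rightarrow> real) \<Rightarrow> (real \<Rightarrow> real) \<Rightarrow> bool" where
  "cartan_ribbon S \<gamma> N \<beta> wm wp \<longleftrightarrow>
     regular_curve_on S \<gamma> N \<and> (\<forall>t. normal_curvature \<gamma> N t \<noteq> 0) \<and>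
     \<beta> = cartan_director \<gamma> N \<and> regular_ribbon \<gamma> \<beta> wm wp"

text \<open>Along a closed curve with nowhere vanishing \<open>\<kappa>\<^sub>n\<close> the director has the same period as the
  curve: it does not depend on the sign of \<open>N\<close>.  Hence a Moebius strip, whose ruling is reversed
  after one period, always has a point with \<open>\<kappa>\<^sub>n = 0\<close>.  We therefore also admit rulings which
  extend \<open>\<plusminus>\<close> the director smoothly over points with \<open>\<kappa>\<^sub>n = \<tau>\<^sub>g = 0\<close>.  (A point with
  \<open>\<kappa>\<^sub>n = 0 \<noteq> \<tau>\<^sub>g\<close> would have its ruling tangent to the curve and is excluded by regularity.)
  Every Cartan ribbon is an extended one.\<close>

definition extended_cartan_ribbon ::
  "(real^3) set \<Rightarrow> (real \<Rightarrow> real^3) \<Rightarrow> (real \<Rightarrow> real^3) \<Rightarrow> (real \<Rightarrow> real^3) \<Rightarrow>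
   (real \<Rightarrow> real) \<Rightarrow> (real \<Rightarrow> real) \<Rightarrow> bool" where
  "extended_cartan_ribbon S \<gamma> N \<beta> wm wp \<longleftrightarrow>
     regular_curve_on S \<gamma> N \<and>
     smooth_on UNIV \<beta> \<and> (\<forall>t. norm (\<beta> t) = 1) \<and> (\<forall>t. N t \<bullet> \<beta> t = 0) \<and>
     (\<forall>t. director_denominator \<gamma> N t *\<^sub>R \<beta> t = director_numerator \<gamma> N t \<or>
          director_denominator \<gamma> N t *\<^sub>R \<beta> t = - director_numerator \<gamma> N t) \<and>
     regular_ribbon \<gamma> \<beta> wm wp"

text \<open>Closed ribbons are parametrized over the whole line; the strip over one period is glued by
  \<open>(t + T, u) \<sim> (t, u)\<close> (annulus) or \<open>(t + T, u) \<sim> (t, -u)\<close> (Moebius strip).  At \<open>u = 0\<close>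
  this says that the center curve is a smooth closed curve.\<close>

definition cylindrical_cartan_ribbon ::
  "(real^3) set \<Rightarrow> (real \<Rightarrow> real^3) \<Rightarrow> (real \<Rightarrow> real^3) \<Rightarrow> (real \<Rightarrow> real^3) \<Rightarrow>
   (real \<Rightarrow> real) \<Rightarrow> (real \<Rightarrow> real) \<Rightarrow> real \<Rightarrow> bool" where
  "cylindrical_cartan_ribbon S \<gamma> N \<beta> wm wp T \<longleftrightarrow>
     cartan_ribbon S \<gamma> N \<beta> wm wp \<and> T > 0 \<and>
     (\<forall>t u. ruled \<gamma> \<beta> (t + T) u = ruled \<gamma> \<beta> t u) \<and>
     (\<forall>t. wp (t + T) = wp t) \<and> (\<forall>t. wm (t + T) = wm t)"

definition moebius_cartan_ribbon ::
  "(real^3) set \<Rightarrow> (real \<Rightarrow> real^3) \<Rightarrow> (real \<Rightarrow> real^3) \<Rightarrow> (real \<Rightarrow> real^3) \<Rightarrow>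
   (real \<Rightarrow> real) \<Rightarrow> (real \<Rightarrow> real) \<Rightarrow> real \<Rightarrow> bool" where
  "moebius_cartan_ribbon S \<gamma> N \<beta> wm wp T \<longleftrightarrow>
     extended_cartan_ribbon S \<gamma> N \<beta> wm wp \<and> T > 0 \<and>
     (\<forall>t u. ruled \<gamma> \<beta> (t + T) u = ruled \<gamma> \<beta> t (- u)) \<and>
     (\<forall>t. wp (t + T) = wm t) \<and> (\<forall>t. wm (t + T) = wp t)"


section \<open>Edges\<close>

text \<open>An edge is \<open>c t = r t (w t)\<close> with \<open>w = wp\<close> or \<open>w = - wm\<close>.  The vector field \<open>d\<close> along it
  is the ruling direction pointing into the ribbon: \<open>d = -\<beta>\<close> for \<open>w = wp\<close> and \<open>d = \<beta>\<close> for
  \<open>w = - wm\<close>.\<close>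

definition edge :: "(real \<Rightarrow> real^3) \<Rightarrow> (real \<Rightarrow> real^3) \<Rightarrow> (real \<Rightarrow> real) \<Rightarrow> real \<Rightarrow> real^3" where
  "edge \<gamma> \<beta> w t = ruled \<gamma> \<beta> t (w t)"

text \<open>The component of \<open>d\<close> orthogonal to the edge, normalized; it is tangent to the ribbon.\<close>

definition inward_conormal ::
  "(real \<Rightarrow> real^3) \<Rightarrow> (real \<Rightarrow> real^3) \<Rightarrow> real \<Rightarrow> real^3" where
  "inward_conormal c d t =
     (let p = d t - (d t \<bullet> unit_tangent c t) *\<^sub>R unit_tangent c t in p /\<^sub>R norm p)"

definition geodesic_curvature ::
  "(real \<Rightarrow> real^3) \<Rightarrow> (real \<Rightarrow> real^3) \<Rightarrow> real \<Rightarrow> real" where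
  "geodesic_curvature c d t =
     (vector_derivative (unit_tangent c) (at t) \<bullet> inward_conormal c d t) / norm (velocity c t)"

definition vec_angle :: "real^3 \<Rightarrow> real^3 \<Rightarrow> real" where
  "vec_angle v w = arccos ((v \<bullet> w) / (norm v * norm w))"

text \<open>The ribbon near an edge point lies in the sector of the tangent plane bounded by the forward
  and the backward edge direction and containing \<open>d\<close>.  Since \<open>d\<close> is transversal to the edge, it
  splits the sector into two sectors of angle less than \<open>pi\<close>.\<close>

definition interior_angle ::
  "(real \<Rightarrow> real^3) \<Rightarrow> (real \<Rightarrow> real^3) \<Rightarrow> real \<Rightarrow> real" where
  "interior_angle c d t =
     vec_angle (vector_derivative c (at_right t)) (d t) +
     vec_angle (d t) (- vector_derivative c (at_left t))"

definition outer_angle ::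
  "(real \<Rightarrow> real^3) \<Rightarrow> (real \<Rightarrow> real^3) \<Rightarrow> real \<Rightarrow> real" where
  "outer_angle c d t = pi - interior_angle c d t"

definition kinks :: "(real \<Rightarrow> real^3) \<Rightarrow> real \<Rightarrow> real set" where
  "kinks c T = {t \<in> {0..<T}. \<not> c differentiable (at t)}"

text \<open>\<open>\<integral> \<kappa>\<^sub>g ds\<close> over the edge arc with parameters in \<open>[0,T]\<close>; the integrand is undefined only at
  finitely many points.\<close>

definition edge_curvature_integral ::
  "(real \<Rightarrow> real^3) \<Rightarrow> (real \<Rightarrow> real^3) \<Rightarrow> real \<Rightarrow> real" where
  "edge_curvature_integral c d T =
     integral {0..T} (\<lambda>t. geodesic_curvature c d t * norm (velocity c t))"

definition edge_angle_sum ::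
  "(real \<Rightarrow> real^3) \<Rightarrow> (real \<Rightarrow> real^3) \<Rightarrow> real \<Rightarrow> real" where
  "edge_angle_sum c d T = (\<Sum>t\<in>kinks c T. outer_angle c d t)"


section \<open>Total curvature integrals of a closed ribbon\<close>

definition ribbon_curvature_integral ::
  "(real \<Rightarrow> real^3) \<Rightarrow> (real \<Rightarrow> real^3) \<Rightarrow> (real \<Rightarrow> real) \<Rightarrow> (real \<Rightarrow> real) \<Rightarrow> real \<Rightarrow> real" where
  "ribbon_curvature_integral \<gamma> \<beta> wm wp T =
     integral {(t, u). t \<in> {0..T} \<and> u \<in> {- wm t..wp t}}
       (\<lambda>(t, u). gauss_curvature (ruled \<gamma> \<beta>) t u * area_density (ruled \<gamma> \<beta>) t u)"

text \<open>For both types the arcs \<open>u = wp\<close> and \<open>u = - wm\<close> over one period together run through the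
  boundary once: they are the two edges of an annulus, and the two halves of the single edge of
  a Moebius strip (whose one-sided derivatives at the junctions are those of the periodically
  extended data).\<close>

definition boundary_curvature_integral ::
  "(real \<Rightarrow> real^3) \<Rightarrow> (real \<Rightarrow> real^3) \<Rightarrow> (real \<Rightarrow> real) \<Rightarrow> (real \<Rightarrow> real) \<Rightarrow> real \<Rightarrow> real" where
  "boundary_curvature_integral \<gamma> \<beta> wm wp T =
     edge_curvature_integral (edge \<gamma> \<beta> wp) (\<lambda>t. - \<beta> t) T +
     edge_curvature_integral (edge \<gamma> \<beta> (\<lambda>t. - wm t)) \<beta> T"

definition boundary_angle_sum ::
  "(real \<Rightarrow> real^3) \<Rightarrow> (real \<Rightarrow> real^3) \<Rightarrow> (real \<Rightarrow> real) \<Rightarrow> (real \<Rightarrow> real) \<Rightarrow> real \<Rightarrow> real" where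
  "boundary_angle_sum \<gamma> \<beta> wm wp T =
     edge_angle_sum (edge \<gamma> \<beta> wp) (\<lambda>t. - \<beta> t) T +
     edge_angle_sum (edge \<gamma> \<beta> (\<lambda>t. - wm t)) \<beta> T"

end

theory Submission
  imports Defs
begin

text \<open>Along a ruling the normal \<open>N\<close> of \<open>S\<close> is orthogonal to \<open>\<gamma>'\<close>, \<open>\<beta>\<close> and \<open>\<beta>'\<close>, so the ribbon is
  developable, \<open>K = 0\<close>, and an orthonormal frame \<open>\<beta>, f\<close> of its tangent planes satisfies
  \<open>\<gamma>' = a \<beta> + b f\<close> and \<open>\<beta>' = \<omega> f\<close>.  If \<open>\<phi>\<close> is the angle from \<open>f\<close> to the edge tangent, so that
  \<open>tan \<phi> = (a + w') / (b + w \<omega>)\<close> for the edge \<open>u = w\<close>, then \<open>\<kappa>\<^sub>g ds = \<plusminus>(\<phi>' - \<omega>) dt\<close> and the outer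
  angle at a kink is \<open>\<plusminus>\<close> the jump of \<open>\<phi>\<close>, with opposite signs for the two edges.  In the sum over
  both edges the integrals of \<open>\<omega>\<close> cancel, and so do the boundary values of \<open>\<phi>\<close>: \<open>\<phi>\<close> is periodic
  on an annulus, and on a Moebius strip \<open>\<phi>\<^sub>+(t + T) = - \<phi>\<^sub>-(t)\<close> and vice versa.\<close>

section \<open>Integration across jumps, and one-sided derivatives\<close>

text \<open>Here \<open>L\<close> and \<open>R\<close> play the left and right limits of a piecewise
  primitive. Induction on the number of interior break points, splitting at one of them. The
  half-open range of the sum makes adjacent intervals add up without counting a jump twice, and the
  jump at \<open>a\<close> turns \<open>L a\<close> into the \<open>R a\<close> of the first
  piece.\<close>

lemma has_integral_with_jumps:
  fixes F L R :: "real \<Rightarrow> real"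
  assumes fin: "\<And>a b. finite (P \<inter> {a..b})"
    and piece: "\<And>a b. a < b \<Longrightarrow> P \<inter> {a<..<b} = {} \<Longrightarrow> (F has_integral (L b - R a)) {a..b}"
    and nojump: "\<And>t. t \<notin> P \<Longrightarrow> R t = L t"
    and "a < b"
  shows "(F has_integral (L b - L a - (\<Sum>t\<in>P \<inter> {a..<b}. R t - L t))) {a..b}"
  using \<open>a < b\<close>
proof (induction "card (P \<inter> {a<..<b})" arbitrary: a b rule: less_induct)
  case less
  have fin': "finite (P \<inter> {x<..<y})" "finite (P \<inter> {x..<y})" for x y
    using fin[of x y] by (auto elim!: rev_finite_subset)
  show ?case
  proof (cases "P \<inter> {a<..<b} = {}")
    case True
    have "(\<Sum>t\<in>P \<inter> {a..<b}. R t - L t) = (\<Sum>t\<in>{a}. R t - L t)"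
    proof (rule sum.mono_neutral_left)
      show "P \<inter> {a..<b} \<subseteq> {a}"
        using True by force
      show "\<forall>t\<in>{a} - P \<inter> {a..<b}. R t - L t = 0"
        using nojump less.prems by auto
    qed auto
    then show ?thesis
      using piece[OF less.prems True] by simp
  next
    case False
    then obtain c where c: "c \<in> P" "a < c" "c < b"
      by auto
    have "card (P \<inter> {a<..<c}) < card (P \<inter> {a<..<b})" "card (P \<inter> {c<..<b}) < card (P \<inter> {a<..<b})"
      using c by (auto intro!: psubset_card_mono fin')
    then have "(F has_integral (L c - L a - (\<Sum>t\<in>P \<inter> {a..<c}. R t - L t))) {a..c}"
      "(F has_integral (L b - L c - (\<Sum>t\<in>P \<inter> {c..<b}. R t - L t))) {c..b}"
      using less.hyps c by blast+
    then have "(F has_integral (L c - L a - (\<Sum>t\<in>P \<inter> {a..<c}. R t - L t)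
        + (L b - L c - (\<Sum>t\<in>P \<inter> {c..<b}. R t - L t)))) {a..b}"
      using c by (intro has_integral_combine[of a c b]) auto
    moreover have "(\<Sum>t\<in>P \<inter> {a..<b}. R t - L t)
        = (\<Sum>t\<in>P \<inter> {a..<c}. R t - L t) + (\<Sum>t\<in>P \<inter> {c..<b}. R t - L t)"
      using c by (subst sum.union_disjoint[symmetric])
        (auto intro!: sum.cong fin' simp flip: Int_Un_distrib)
    ultimately show ?thesis
      by (simp add: algebra_simps)
  qed
qed

text \<open>An edge agrees with a smooth curve only on a closed piece; its one-sided derivatives at
  the ends of the piece are read off that curve.\<close>

lemma has_vector_derivative_at_right_transform:
  fixes f g :: "real \<Rightarrow> 'a::real_normed_vector"
  assumes "(f has_vector_derivative v) (at a)" "a < b" "\<And>t. t \<in> {a..b} \<Longrightarrow> g t = f t"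
  shows "(g has_vector_derivative v) (at_right a)"
proof -
  have "(f has_vector_derivative v) (at a within {a..b})"
    using assms(1) has_vector_derivative_at_within by blast
  then have "(g has_vector_derivative v) (at a within {a..b})"
    by (rule has_vector_derivative_transform[rotated 2]) (use assms in auto)
  then show ?thesis
    using assms(2) by (simp add: at_within_Icc_at_right)
qed

lemma has_vector_derivative_at_left_transform:
  fixes f g :: "real \<Rightarrow> 'a::real_normed_vector"
  assumes "(f has_vector_derivative v) (at b)" "a < b" "\<And>t. t \<in> {a..b} \<Longrightarrow> g t = f t"
  shows "(g has_vector_derivative v) (at_left b)"
proof -
  have "(f has_vector_derivative v) (at b within {a..b})"
    using assms(1) has_vector_derivative_at_within by blast
  then have "(g has_vector_derivative v) (at b within {a..b})"
    by (rule has_vector_derivative_transform[rotated 2]) (use assms in auto)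
  then show ?thesis
    using assms(2) by (simp add: at_within_Icc_at_left)
qed

lemma locally_finite_gaps:
  fixes P :: "real set"
  assumes "\<And>a b. finite (P \<inter> {a..b})"
  obtains e where "e > 0" "P \<inter> {t<..<t+e} = {}" "P \<inter> {t-e<..<t} = {}"
proof -
  obtain d where d: "d > 0" "\<forall>x\<in>P \<inter> {t-1..t+1}. x \<noteq> t \<longrightarrow> d \<le> dist t x"
    using finite_set_avoid[OF assms] by blast
  show ?thesis
  \<comment> \<open>The cut at 1 keeps both gaps inside the interval on which finiteness of
    \<open>P\<close> gave \<open>d\<close>.\<close>
  proof (rule that[of "min d 1"])
    show "P \<inter> {t<..<t + min d 1} = {}" "P \<inter> {t - min d 1<..<t} = {}"
      using d(2) by (force simp: dist_real_def)+
  qed (use d in auto)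
qed

text \<open>On the line a derivative is determined by its value in direction 1, and
  \<open>Ck_on\<close> passes to each directional derivative with its order lowered by one.\<close>

lemma smooth_on_real_deriv:
  fixes f :: "real \<Rightarrow> 'b::real_normed_vector"
  assumes "smooth_on UNIV f"
  obtains f1 where "smooth_on UNIV f1" "\<And>t. (f has_vector_derivative f1 t) (at t)"
proof -
  have S: "Ck_on (Suc k) UNIV f" for k
    using assms by (simp only: smooth_on_def)
  show ?thesis
  proof (rule that[of "\<lambda>t. frechet_derivative f (at t) 1"])
    show "smooth_on UNIV (\<lambda>t. frechet_derivative f (at t) 1)"
      unfolding smooth_on_def using S by auto
    fix t
    have "(f has_derivative frechet_derivative f (at t)) (at t)"
      using S[of 0] by (simp add: frechet_derivative_works)
    moreover have "frechet_derivative f (at t) h = h *\<^sub>R frechet_derivative f (at t) 1" for h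
      using linear_scale[OF has_derivative_linear[OF calculation], of h 1] by simp
    then have "frechet_derivative f (at t) = (\<lambda>h. h *\<^sub>R frechet_derivative f (at t) 1)" ..
    ultimately show "(f has_vector_derivative frechet_derivative f (at t) 1) (at t)"
      by (simp add: has_vector_derivative_def)
  qed
qed

section \<open>Edges of a flat strip\<close>

text \<open>The moving frame \<open>\<beta>, f\<close> spans the tangent planes of the strip; it develops into the plane
  with rotation rate \<open>\<omega>\<close>.\<close>

locale flat_strip =
  fixes \<gamma> \<beta> f :: "real \<Rightarrow> real^3" and a b \<omega> :: "real \<Rightarrow> real"
  assumes \<gamma>_deriv: "(\<gamma> has_vector_derivative a t *\<^sub>R \<beta> t + b t *\<^sub>R f t) (at t)"
    and \<beta>_deriv: "(\<beta> has_vector_derivative \<omega> t *\<^sub>R f t) (at t)"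
    and f_diff: "f differentiable (at t)"
    and coeff_diff: "a differentiable (at t)" "b differentiable (at t)" "\<omega> differentiable (at t)"
    and orthonormal: "\<beta> t \<bullet> \<beta> t = 1" "f t \<bullet> f t = 1" "\<beta> t \<bullet> f t = 0"
begin

text \<open>The angle of \<open>v\<close>, measured from \<open>f t\<close> towards
  \<open>\<beta> t\<close>. It is the true polar angle when the \<open>f\<close> component is
  positive, as it is for edge tangents; a single branch of \<open>arctan\<close> then suffices and
  no multiples of \<open>2 * pi\<close> arise.\<close>

definition slope_angle :: "real \<Rightarrow> real^3 \<Rightarrow> real" where
  "slope_angle t v = arctan ((v \<bullet> \<beta> t) / (v \<bullet> f t))"

text \<open>The left slope makes sense at the parameter 0 too, because the data extend over the
  whole line; it is what gets compared at both ends of a period.\<close>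

definition left_slope :: "(real \<Rightarrow> real^3) \<Rightarrow> real \<Rightarrow> real" where
  "left_slope c t = slope_angle t (vector_derivative c (at_left t))"

definition right_slope :: "(real \<Rightarrow> real^3) \<Rightarrow> real \<Rightarrow> real" where
  "right_slope c t = slope_angle t (vector_derivative c (at_right t))"

lemma frame_coords:
  "(x *\<^sub>R \<beta> t + y *\<^sub>R f t) \<bullet> \<beta> t = x" "(x *\<^sub>R \<beta> t + y *\<^sub>R f t) \<bullet> f t = y"
  "norm (x *\<^sub>R \<beta> t + y *\<^sub>R f t) = sqrt (x\<^sup>2 + y\<^sup>2)"
  using orthonormal[of t]
  by (simp_all add: inner_add_left inner_add_right inner_commute[of "f t" "\<beta> t"]
      norm_eq_sqrt_inner power2_eq_square)

text \<open>For \<open>y > 0\<close> the positive cosine of \<open>arctan\<close> has the sign of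
  the \<open>f\<close> component, so no quadrant is confused.\<close>

lemma normalize_polar:
  assumes "y > 0"
  shows "(x *\<^sub>R \<beta> t + y *\<^sub>R f t) /\<^sub>R norm (x *\<^sub>R \<beta> t + y *\<^sub>R f t)
    = sin (arctan (x/y)) *\<^sub>R \<beta> t + cos (arctan (x/y)) *\<^sub>R f t"
proof -
  have "sqrt (x\<^sup>2 + y\<^sup>2) = y * sqrt (1 + (x/y)\<^sup>2)"
    using assms by (intro real_sqrt_unique) (auto simp: power_mult_distrib field_simps)
  moreover have "sqrt (1 + (x/y)\<^sup>2) > 0"
    by (simp add: add_pos_nonneg)
  ultimately show ?thesis
    unfolding frame_coords sin_arctan cos_arctan scaleR_add_right scaleR_scaleR
    using assms by (simp add: field_simps)
qed

text \<open>Differentiating \<open>\<beta> \<bullet> f = 0\<close> and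
  \<open>f \<bullet> f = 1\<close> fixes the tangential part of \<open>f1\<close>. The part normal
  to the strip stays undetermined, but it is orthogonal to the conormal and so does not enter the
  geodesic curvature.\<close>

lemma f_deriv:
  obtains f1 where "(f has_vector_derivative f1) (at t)" "f1 \<bullet> \<beta> t = - \<omega> t" "f1 \<bullet> f t = 0"
proof -
  obtain f1 where f1: "(f has_vector_derivative f1) (at t)"
    using f_diff vector_derivative_works by blast
  have "((\<lambda>t. \<beta> t \<bullet> f t) has_vector_derivative (\<beta> t \<bullet> f1 + (\<omega> t *\<^sub>R f t) \<bullet> f t)) (at t)"
    by (rule bounded_bilinear.has_vector_derivative[OF bounded_bilinear_inner \<beta>_deriv f1])
  then have 1: "\<beta> t \<bullet> f1 + \<omega> t = 0"
    using orthonormal vector_derivative_at by fastforce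
  have "((\<lambda>t. f t \<bullet> f t) has_vector_derivative (f t \<bullet> f1 + f1 \<bullet> f t)) (at t)"
    by (rule bounded_bilinear.has_vector_derivative[OF bounded_bilinear_inner f1 f1])
  then have 2: "f t \<bullet> f1 + f1 \<bullet> f t = 0"
    using orthonormal vector_derivative_at by fastforce
  show ?thesis
    using that[OF f1] 1 2 by (simp add: inner_commute)
qed

text \<open>The sign \<open>\<sigma>\<close> selects the edge: \<open>-1\<close> for
  \<open>u = wp\<close> and \<open>1\<close> for \<open>u = - wm\<close>, so that
  \<open>\<sigma> *\<^sub>R \<beta> t\<close> points inward. Both angles lie strictly between 0 and
  \<open>pi\<close>, so \<open>arccos\<close> inverts the cosine.\<close>

lemma vec_angle_polar:
  assumes "y > 0" "\<sigma> = 1 \<or> \<sigma> = -1"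
  shows "vec_angle (x *\<^sub>R \<beta> t + y *\<^sub>R f t) (\<sigma> *\<^sub>R \<beta> t) = pi/2 - \<sigma> * arctan (x/y)"
    and "vec_angle (\<sigma> *\<^sub>R \<beta> t) (- (x *\<^sub>R \<beta> t + y *\<^sub>R f t)) = pi/2 + \<sigma> * arctan (x/y)"
proof -
  let ?v = "x *\<^sub>R \<beta> t + y *\<^sub>R f t" and ?\<phi> = "arctan (x/y)"
  have "(?v /\<^sub>R norm ?v) \<bullet> \<beta> t = sin ?\<phi>"
    unfolding normalize_polar[OF assms(1)] by (rule frame_coords)
  then have *: "(?v \<bullet> \<beta> t) / norm ?v = sin ?\<phi>"
    by (simp only: inner_scaleR_left divide_inverse mult.commute)
  have n: "norm (\<sigma> *\<^sub>R \<beta> t) = 1"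
    using assms(2) orthonormal[of t] by (auto simp: norm_eq_sqrt_inner)
  have b: "- (pi/2) < ?\<phi>" "?\<phi> < pi/2"
    using arctan[of "x/y"] by blast+
  have "vec_angle ?v (\<sigma> *\<^sub>R \<beta> t) = arccos (\<sigma> * sin ?\<phi>)"
    unfolding vec_angle_def n * [symmetric] by simp
  also have "\<sigma> * sin ?\<phi> = cos (pi/2 - \<sigma> * ?\<phi>)"
    using assms(2) by (auto simp: cos_diff)
  also have "arccos \<dots> = pi/2 - \<sigma> * ?\<phi>"
    using assms(2) b by (intro arccos_cos) auto
  finally show "vec_angle ?v (\<sigma> *\<^sub>R \<beta> t) = pi/2 - \<sigma> * ?\<phi>" .
  have "vec_angle (\<sigma> *\<^sub>R \<beta> t) (- ?v) = arccos (- \<sigma> * sin ?\<phi>)"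
    unfolding vec_angle_def n * [symmetric] norm_minus_cancel
    by (simp only: inner_minus_right inner_scaleR_left inner_commute[of "\<beta> t"] mult_1 mult_minus_left
        times_divide_eq_right minus_divide_left)
  also have "- \<sigma> * sin ?\<phi> = cos (pi/2 + \<sigma> * ?\<phi>)"
    using assms(2) by (auto simp: cos_add)
  also have "arccos \<dots> = pi/2 + \<sigma> * ?\<phi>"
    using assms(2) b by (intro arccos_cos) auto
  finally show "vec_angle (\<sigma> *\<^sub>R \<beta> t) (- ?v) = pi/2 + \<sigma> * ?\<phi>" .
qed

lemma edge_deriv:
  assumes "(g has_vector_derivative g1) (at t)"
  shows "(edge \<gamma> \<beta> g has_vector_derivative (a t + g1) *\<^sub>R \<beta> t + (b t + g t * \<omega> t) *\<^sub>R f t) (at t)"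
proof -
  have "((\<lambda>t. \<gamma> t + g t *\<^sub>R \<beta> t) has_vector_derivative
      a t *\<^sub>R \<beta> t + b t *\<^sub>R f t + (g t *\<^sub>R (\<omega> t *\<^sub>R f t) + g1 *\<^sub>R \<beta> t)) (at t)"
    by (intro has_vector_derivative_add \<gamma>_deriv
        bounded_bilinear.has_vector_derivative[OF bounded_bilinear_scaleR] assms \<beta>_deriv)
  then show ?thesis
    by (simp add: edge_def[abs_def] ruled_def algebra_simps)
qed

text \<open>Removing the tangential part of the inward ruling leaves
  \<open>\<sigma> * cos \<phi>\<close> times the tangent turned by a right angle;
  \<open>cos \<phi> > 0\<close> preserves the side after normalization.\<close>

lemma polar_conormal:
  assumes "\<sigma> = 1 \<or> \<sigma> = -1" "unit_tangent c t = sin \<phi> *\<^sub>R \<beta> t + cos \<phi> *\<^sub>R f t" "cos \<phi> > 0"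
  shows "inward_conormal c (\<lambda>t. \<sigma> *\<^sub>R \<beta> t) t = \<sigma> *\<^sub>R (cos \<phi> *\<^sub>R \<beta> t - sin \<phi> *\<^sub>R f t)"
proof -
  have 1: "\<sigma> *\<^sub>R \<beta> t \<bullet> unit_tangent c t = \<sigma> * sin \<phi>"
    unfolding assms(2) using orthonormal[of t] by (simp add: inner_add_right)
  have 2: "1 - (sin \<phi>)\<^sup>2 = (cos \<phi>)\<^sup>2"
    by (simp add: cos_squared_eq)
  have "\<sigma> *\<^sub>R \<beta> t - (\<sigma> *\<^sub>R \<beta> t \<bullet> unit_tangent c t) *\<^sub>R unit_tangent c t
      = \<sigma> *\<^sub>R ((1 - (sin \<phi>)\<^sup>2) *\<^sub>R \<beta> t - (sin \<phi> * cos \<phi>) *\<^sub>R f t)"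
    unfolding 1 unfolding assms(2) by (simp add: algebra_simps power2_eq_square)
  also have "\<dots> = (\<sigma> * cos \<phi>) *\<^sub>R (cos \<phi> *\<^sub>R \<beta> t - sin \<phi> *\<^sub>R f t)"
    unfolding 2 by (simp add: algebra_simps power2_eq_square)
  finally have p: "\<sigma> *\<^sub>R \<beta> t - (\<sigma> *\<^sub>R \<beta> t \<bullet> unit_tangent c t) *\<^sub>R unit_tangent c t
      = (\<sigma> * cos \<phi>) *\<^sub>R (cos \<phi> *\<^sub>R \<beta> t - sin \<phi> *\<^sub>R f t)" .
  have "norm (cos \<phi> *\<^sub>R \<beta> t - sin \<phi> *\<^sub>R f t) = 1"
    using frame_coords(3)[of "cos \<phi>" t "- sin \<phi>"] by simp
  then have "norm ((\<sigma> * cos \<phi>) *\<^sub>R (cos \<phi> *\<^sub>R \<beta> t - sin \<phi> *\<^sub>R f t)) = cos \<phi>"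
    using assms(1,3) by auto
  then show ?thesis
    unfolding inward_conormal_def p Let_def using assms(3) by simp
qed

text \<open>In the developed plane the unit tangent makes the angle \<open>\<phi>\<close> with a frame which itself
  rotates at rate \<open>\<omega>\<close>.\<close>

lemma polar_geodesic_curvature:
  assumes "\<sigma> = 1 \<or> \<sigma> = -1" "open U" "t \<in> U"
    and ut: "\<And>s. s \<in> U \<Longrightarrow> unit_tangent c s = sin (\<phi> s) *\<^sub>R \<beta> s + cos (\<phi> s) *\<^sub>R f s"
    and c: "cos (\<phi> t) > 0" and v: "velocity c t \<noteq> 0"
    and \<phi>: "(\<phi> has_real_derivative \<phi>1) (at t)"
  shows "geodesic_curvature c (\<lambda>t. \<sigma> *\<^sub>R \<beta> t) t * norm (velocity c t) = \<sigma> * (\<phi>1 - \<omega> t)"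
proof -
  obtain f1 where f1: "(f has_vector_derivative f1) (at t)" "f1 \<bullet> \<beta> t = - \<omega> t" "f1 \<bullet> f t = 0"
    by (rule f_deriv)
  have sc: "((\<lambda>s. sin (\<phi> s)) has_vector_derivative cos (\<phi> t) * \<phi>1) (at t)"
    "((\<lambda>s. cos (\<phi> s)) has_vector_derivative - sin (\<phi> t) * \<phi>1) (at t)"
    unfolding has_real_derivative_iff_has_vector_derivative[symmetric]
    by (auto intro!: derivative_eq_intros \<phi>)
  let ?E = "sin (\<phi> t) *\<^sub>R (\<omega> t *\<^sub>R f t) + (cos (\<phi> t) * \<phi>1) *\<^sub>R \<beta> t
      + (cos (\<phi> t) *\<^sub>R f1 + (- sin (\<phi> t) * \<phi>1) *\<^sub>R f t)"
  have "((\<lambda>s. sin (\<phi> s) *\<^sub>R \<beta> s + cos (\<phi> s) *\<^sub>R f s) has_vector_derivative ?E) (at t)"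
    by (intro has_vector_derivative_add
        bounded_bilinear.has_vector_derivative[OF bounded_bilinear_scaleR] sc f1 \<beta>_deriv)
  then have "(unit_tangent c has_vector_derivative ?E) (at t)"
    by (rule has_vector_derivative_transform_within_open[OF _ assms(2,3)]) (simp add: ut)
  then have "vector_derivative (unit_tangent c) (at t) = ?E"
    by (rule vector_derivative_at)
  moreover have "?E \<bullet> (cos (\<phi> t) *\<^sub>R \<beta> t - sin (\<phi> t) *\<^sub>R f t)
      = (\<phi>1 - \<omega> t) * ((sin (\<phi> t))\<^sup>2 + (cos (\<phi> t))\<^sup>2)"
    using f1 orthonormal[of t]
    by (simp add: inner_add_left inner_diff_right inner_commute[of "f t" "\<beta> t"]
        algebra_simps power2_eq_square del: sin_cos_squared_add sin_cos_squared_add2 sin_cos_squared_add3)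
  ultimately show ?thesis
    unfolding geodesic_curvature_def polar_conormal[OF assms(1) ut[OF \<open>t \<in> U\<close>] c] using v by simp
qed

lemma slope_angle_coords: "slope_angle t (x *\<^sub>R \<beta> t + y *\<^sub>R f t) = arctan (x / y)"
  by (simp only: slope_angle_def frame_coords)

text \<open>By \<open>polar_geodesic_curvature\<close> and \<open>\<sigma> * \<sigma> = 1\<close>
  the integrand equals the derivative of the slope angle inside the piece, so the integral is a
  difference of slopes.\<close>

lemma edge_piece:
  assumes "p < q" and w: "\<And>t. t \<in> {p..q} \<Longrightarrow> w t = g t"
    and g: "\<And>t. (g has_vector_derivative g1 t) (at t)"
    and g1: "\<And>t. g1 differentiable (at t)"
    and pos: "\<And>t. b t + w t * \<omega> t > 0"
    and \<sigma>: "\<sigma> = 1 \<or> \<sigma> = -1"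
  shows "(edge \<gamma> \<beta> w has_vector_derivative (a p + g1 p) *\<^sub>R \<beta> p + (b p + w p * \<omega> p) *\<^sub>R f p) (at_right p)"
    and "(edge \<gamma> \<beta> w has_vector_derivative (a q + g1 q) *\<^sub>R \<beta> q + (b q + w q * \<omega> q) *\<^sub>R f q) (at_left q)"
    and "((\<lambda>t. \<sigma> * (geodesic_curvature (edge \<gamma> \<beta> w) (\<lambda>t. \<sigma> *\<^sub>R \<beta> t) t * norm (velocity (edge \<gamma> \<beta> w) t)) + \<omega> t)
      has_integral (left_slope (edge \<gamma> \<beta> w) q - right_slope (edge \<gamma> \<beta> w) p)) {p..q}"
proof -
  let ?c = "edge \<gamma> \<beta> w"
  \<comment> \<open>Built from \<open>g\<close> and not from \<open>w\<close>, this angle is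
    differentiable also at \<open>p\<close> and \<open>q\<close>, where its values are the one-sided
    slopes of the edge.\<close>
  define \<phi> where "\<phi> t = arctan ((a t + g1 t) / (b t + g t * \<omega> t))" for t
  note edge_g = edge_deriv[OF g]
  have cg: "?c t = edge \<gamma> \<beta> g t" if "t \<in> {p..q}" for t
    using w[OF that] by (simp add: edge_def)
  show right: "(?c has_vector_derivative (a p + g1 p) *\<^sub>R \<beta> p + (b p + w p * \<omega> p) *\<^sub>R f p) (at_right p)"
    using has_vector_derivative_at_right_transform[OF edge_g \<open>p < q\<close> cg] w \<open>p < q\<close> by simp
  show left: "(?c has_vector_derivative (a q + g1 q) *\<^sub>R \<beta> q + (b q + w q * \<omega> q) *\<^sub>R f q) (at_left q)"
    using has_vector_derivative_at_left_transform[OF edge_g \<open>p < q\<close> cg] w \<open>p < q\<close> by simp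
  have slopes: "right_slope ?c p = \<phi> p" "left_slope ?c q = \<phi> q"
    unfolding right_slope_def left_slope_def \<phi>_def
    using vector_derivative_within[OF _ right] vector_derivative_within[OF _ left] w \<open>p < q\<close>
    by (simp_all add: slope_angle_coords)
  have pos': "b t + g t * \<omega> t > 0" if "t \<in> {p..q}" for t
    using pos[of t] w[OF that] by simp
  have \<phi>_diff: "\<phi> differentiable (at t)" if "t \<in> {p..q}" for t
  proof -
    have "g differentiable (at t)"
      using g differentiableI_vector by blast
    then have "(\<lambda>t. (a t + g1 t) / (b t + g t * \<omega> t)) differentiable (at t)"
      using pos'[OF that] by (intro derivative_intros coeff_diff g1) auto
    then obtain D where "((\<lambda>t. (a t + g1 t) / (b t + g t * \<omega> t)) has_real_derivative D) (at t)"
      by (auto simp: real_differentiable_def)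
    from DERIV_chain2[OF DERIV_arctan this] show ?thesis
      unfolding \<phi>_def[abs_def] real_differentiable_def by blast
  qed
  have vel: "velocity ?c t = (a t + g1 t) *\<^sub>R \<beta> t + (b t + g t * \<omega> t) *\<^sub>R f t" if "t \<in> {p<..<q}" for t
    by (rule vector_derivative_at, rule has_vector_derivative_transform_within_open[OF edge_g, of "{p<..<q}"])
      (use that cg in auto)
  have kg: "\<sigma> * (geodesic_curvature ?c (\<lambda>t. \<sigma> *\<^sub>R \<beta> t) t * norm (velocity ?c t)) + \<omega> t
      = deriv \<phi> t" if t: "t \<in> {p<..<q}" for t
  proof -
    have "(\<phi> has_real_derivative deriv \<phi> t) (at t)"
      using \<phi>_diff[of t] t by (simp add: DERIV_deriv_iff_real_differentiable)
    moreover have "unit_tangent ?c s = sin (\<phi> s) *\<^sub>R \<beta> s + cos (\<phi> s) *\<^sub>R f s" if "s \<in> {p<..<q}" for s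
      unfolding unit_tangent_def vel[OF that] \<phi>_def
      using that pos' by (intro normalize_polar) auto
    moreover have "cos (\<phi> t) > 0"
      unfolding \<phi>_def using arctan by (intro cos_gt_zero_pi) auto
    moreover have "velocity ?c t \<noteq> 0"
      using pos'[of t] t frame_coords(2)[of "a t + g1 t" t "b t + g t * \<omega> t"]
      unfolding vel[OF t] by auto
    ultimately have "geodesic_curvature ?c (\<lambda>t. \<sigma> *\<^sub>R \<beta> t) t * norm (velocity ?c t)
        = \<sigma> * (deriv \<phi> t - \<omega> t)"
      using t \<sigma> by (intro polar_geodesic_curvature[of \<sigma> "{p<..<q}"]) auto
    then show ?thesis
      using \<sigma> by auto
  qed
  \<comment> \<open>The integrand uses two-sided derivatives of the edge, which may fail to exist at
    \<open>p\<close> and \<open>q\<close>; hence the fundamental theorem with derivatives only in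
    the interior.\<close>
  show "((\<lambda>t. \<sigma> * (geodesic_curvature ?c (\<lambda>t. \<sigma> *\<^sub>R \<beta> t) t * norm (velocity ?c t)) + \<omega> t)
      has_integral (left_slope ?c q - right_slope ?c p)) {p..q}"
    unfolding slopes
  proof (rule fundamental_theorem_of_calculus_interior)
    show "continuous_on {p..q} \<phi>"
      using \<phi>_diff differentiable_imp_continuous_within
      by (metis continuous_at_imp_continuous_on)
    show "(\<phi> has_vector_derivative \<sigma> * (geodesic_curvature ?c (\<lambda>t. \<sigma> *\<^sub>R \<beta> t) t * norm (velocity ?c t)) + \<omega> t) (at t)"
      if "t \<in> {p<..<q}" for t
      unfolding kg[OF that] has_real_derivative_iff_has_vector_derivative[symmetric]
      using \<phi>_diff[of t] that by (simp add: DERIV_deriv_iff_real_differentiable)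
  qed (use \<open>p < q\<close> in simp)
qed

text \<open>Continuity of \<open>w\<close> gives both one-sided tangents the same \<open>f\<close>
  component. The interior angle is the sum of \<open>pi/2\<close> minus \<open>\<sigma>\<close>
  times the right slope and \<open>pi/2\<close> plus \<open>\<sigma>\<close> times the left
  slope.\<close>

lemma edge_outer_angle:
  assumes "b t + w t * \<omega> t > 0" "\<sigma> = 1 \<or> \<sigma> = -1"
    and "(edge \<gamma> \<beta> w has_vector_derivative x *\<^sub>R \<beta> t + (b t + w t * \<omega> t) *\<^sub>R f t) (at_left t)"
    and "(edge \<gamma> \<beta> w has_vector_derivative y *\<^sub>R \<beta> t + (b t + w t * \<omega> t) *\<^sub>R f t) (at_right t)"
  shows "outer_angle (edge \<gamma> \<beta> w) (\<lambda>t. \<sigma> *\<^sub>R \<beta> t) t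
    = \<sigma> * (right_slope (edge \<gamma> \<beta> w) t - left_slope (edge \<gamma> \<beta> w) t)"
proof -
  have "vector_derivative (edge \<gamma> \<beta> w) (at_left t) = x *\<^sub>R \<beta> t + (b t + w t * \<omega> t) *\<^sub>R f t"
    "vector_derivative (edge \<gamma> \<beta> w) (at_right t) = y *\<^sub>R \<beta> t + (b t + w t * \<omega> t) *\<^sub>R f t"
    using vector_derivative_within[OF _ assms(3)] vector_derivative_within[OF _ assms(4)] by simp_all
  then show ?thesis
    unfolding outer_angle_def interior_angle_def right_slope_def left_slope_def
    by (simp only: vec_angle_polar[OF assms(1,2)] slope_angle_coords right_diff_distrib)
qed

text \<open>The jumps of the slope angle missing from the integral are exactly what the outer angles
  supply, so only the end values and the rotation of the frame survive.\<close>

lemma edge_total: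
  assumes w: "piecewise_smooth w" and pos: "\<And>t. b t + w t * \<omega> t > 0"
    and \<sigma>: "\<sigma> = 1 \<or> \<sigma> = -1" and "T > 0"
  shows "edge_curvature_integral (edge \<gamma> \<beta> w) (\<lambda>t. \<sigma> *\<^sub>R \<beta> t) T + edge_angle_sum (edge \<gamma> \<beta> w) (\<lambda>t. \<sigma> *\<^sub>R \<beta> t) T
    = \<sigma> * (left_slope (edge \<gamma> \<beta> w) T - left_slope (edge \<gamma> \<beta> w) 0 - integral {0..T} \<omega>)"
proof -
  let ?c = "edge \<gamma> \<beta> w" and ?d = "\<lambda>t. \<sigma> *\<^sub>R \<beta> t"
  let ?kg = "\<lambda>t. geodesic_curvature ?c ?d t * norm (velocity ?c t)"
  let ?L = "left_slope ?c" and ?R = "right_slope ?c"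
  from w obtain P where "(\<forall>p q. finite (P \<inter> {p..q})) \<and> (\<forall>p q. p < q \<and> P \<inter> {p<..<q} = {} \<longrightarrow>
      (\<exists>g. smooth_on UNIV g \<and> (\<forall>t\<in>{p..q}. w t = g t)))"
    unfolding piecewise_smooth_def ..
  then have P: "finite (P \<inter> {p..q})"
    and piece: "p < q \<and> P \<inter> {p<..<q} = {} \<longrightarrow> (\<exists>g. smooth_on UNIV g \<and> (\<forall>t\<in>{p..q}. w t = g t))" for p q
    by simp_all
  have piece': "\<exists>g g1. (\<forall>t\<in>{p..q}. w t = g t) \<and> (\<forall>t. (g has_vector_derivative g1 t) (at t))
      \<and> (\<forall>t. g1 differentiable (at t))" if pq: "p < q" "P \<inter> {p<..<q} = {}" for p q
  proof -
    obtain g where g: "smooth_on UNIV g" "\<forall>t\<in>{p..q}. w t = g t"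
      using piece[of p q] pq by auto
    obtain g1 where g1: "smooth_on UNIV g1" "\<And>t. (g has_vector_derivative g1 t) (at t)"
      using smooth_on_real_deriv[OF g(1)] by blast
    moreover have "g1 differentiable (at t)" for t
      using smooth_on_real_deriv[OF g1(1)] differentiableI_vector by blast
    ultimately show ?thesis
      using g(2) by blast
  qed
  have integral_piece: "((\<lambda>t. \<sigma> * ?kg t + \<omega> t) has_integral (?L q - ?R p)) {p..q}"
    if pq: "p < q" "P \<inter> {p<..<q} = {}" for p q
  proof -
    obtain g g1 where "\<And>t. t \<in> {p..q} \<Longrightarrow> w t = g t" "\<And>t. (g has_vector_derivative g1 t) (at t)"
      "\<And>t. g1 differentiable (at t)"
      using piece'[OF pq] by metis
    then show ?thesis
      by (rule edge_piece(3)[OF pq(1) _ _ _ pos \<sigma>])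
  qed
  have smooth_at: "?c differentiable (at t)" if "t \<notin> P" for t
  proof -
    obtain e where e: "e > 0" "P \<inter> {t<..<t+e} = {}" "P \<inter> {t-e<..<t} = {}"
      using locally_finite_gaps[OF P] by blast
    have "x \<notin> P" if "x \<in> {t-e<..<t+e}" for x
      using e \<open>t \<notin> P\<close> that by (cases x t rule: linorder_cases) auto
    then have "P \<inter> {t-e<..<t+e} = {}"
      by blast
    then obtain g g1 where g: "\<forall>s\<in>{t-e..t+e}. w s = g s" "\<forall>t. (g has_vector_derivative g1 t) (at t)"
      using piece'[of "t-e" "t+e"] e(1) by auto
    have "(?c has_vector_derivative (a t + g1 t) *\<^sub>R \<beta> t + (b t + g t * \<omega> t) *\<^sub>R f t) (at t)"
      by (rule has_vector_derivative_transform_within_open[OF edge_deriv, of g _ _ "{t-e<..<t+e}"])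
        (use g e(1) in \<open>auto simp: edge_def\<close>)
    then show ?thesis
      by (rule differentiableI_vector)
  qed
  \<comment> \<open>Stated for differentiability of the edge and not for \<open>P\<close>, since
    \<open>P\<close> may contain break points that are not kinks.\<close>
  have nojump: "?R t = ?L t" if "?c differentiable (at t)" for t
  proof -
    have "(?c has_vector_derivative velocity ?c t) (at t within S)" for S
      using that has_vector_derivative_at_within vector_derivative_works by blast
    then show ?thesis
      unfolding right_slope_def left_slope_def
      by (metis vector_derivative_within trivial_limit_at_left_real trivial_limit_at_right_real)
  qed
  have outer: "outer_angle ?c ?d t = \<sigma> * (?R t - ?L t)" for t
  proof -
    obtain e where e: "e > 0" "P \<inter> {t<..<t+e} = {}" "P \<inter> {t-e<..<t} = {}"
      using locally_finite_gaps[OF P] by blast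
    obtain x where x: "(?c has_vector_derivative x *\<^sub>R \<beta> t + (b t + w t * \<omega> t) *\<^sub>R f t) (at_right t)"
    proof -
      have "t < t + e" using e(1) by simp
      obtain g g1 where g: "\<And>s. s \<in> {t..t+e} \<Longrightarrow> w s = g s" "\<And>t. (g has_vector_derivative g1 t) (at t)"
        "\<And>t. g1 differentiable (at t)"
        using piece'[OF \<open>t < t + e\<close> e(2)] by metis
      show ?thesis
        by (rule that[OF edge_piece(1)[OF \<open>t < t + e\<close> g pos \<sigma>]])
    qed
    obtain y where y: "(?c has_vector_derivative y *\<^sub>R \<beta> t + (b t + w t * \<omega> t) *\<^sub>R f t) (at_left t)"
    proof -
      have "t - e < t" using e(1) by simp
      obtain g g1 where g: "\<And>s. s \<in> {t-e..t} \<Longrightarrow> w s = g s" "\<And>t. (g has_vector_derivative g1 t) (at t)"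
        "\<And>t. g1 differentiable (at t)"
        using piece'[OF \<open>t - e < t\<close> e(3)] by metis
      show ?thesis
        by (rule that[OF edge_piece(2)[OF \<open>t - e < t\<close> g pos \<sigma>]])
    qed
    show ?thesis
      by (rule edge_outer_angle[OF pos \<sigma> y x])
  qed
  have finP: "finite (P \<inter> {0..<T})"
    using P[of 0 T] by (auto elim!: rev_finite_subset)
  have "edge_angle_sum ?c ?d T = (\<Sum>t\<in>kinks ?c T. \<sigma> * (?R t - ?L t))"
    unfolding edge_angle_sum_def outer ..
  \<comment> \<open>Every kink lies in \<open>P\<close>, and the other points of \<open>P\<close>
    contribute zero jumps. Both index sets contain the parameter 0 as a candidate and exclude
    \<open>T\<close>.\<close>
  also have "\<dots> = (\<Sum>t\<in>P \<inter> {0..<T}. \<sigma> * (?R t - ?L t))"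
    using smooth_at nojump finP by (intro sum.mono_neutral_left) (auto simp: kinks_def)
  finally have angles: "edge_angle_sum ?c ?d T = \<sigma> * (\<Sum>t\<in>P \<inter> {0..<T}. ?R t - ?L t)"
    by (simp only: sum_distrib_left)
  have "((\<lambda>t. \<sigma> * ?kg t + \<omega> t) has_integral
      (?L T - ?L 0 - (\<Sum>t\<in>P \<inter> {0..<T}. ?R t - ?L t))) {0..T}"
    using P integral_piece nojump smooth_at \<open>T > 0\<close> by (intro has_integral_with_jumps) auto
  moreover have "(\<omega> has_integral integral {0..T} \<omega>) {0..T}"
    using coeff_diff(3) differentiable_imp_continuous_within
    by (intro integrable_integral integrable_continuous_interval continuous_at_imp_continuous_on) blast
  \<comment> \<open>Subtracting \<open>\<omega>\<close> and multiplying once more by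
    \<open>\<sigma>\<close> isolates the curvature term.\<close>
  ultimately have "((\<lambda>t. \<sigma> * (\<sigma> * ?kg t + \<omega> t - \<omega> t)) has_integral
      \<sigma> * (?L T - ?L 0 - (\<Sum>t\<in>P \<inter> {0..<T}. ?R t - ?L t) - integral {0..T} \<omega>)) {0..T}"
    by (intro has_integral_mult_right has_integral_diff)
  then have "(?kg has_integral
      \<sigma> * (?L T - ?L 0 - (\<Sum>t\<in>P \<inter> {0..<T}. ?R t - ?L t) - integral {0..T} \<omega>)) {0..T}"
    using \<sigma> by auto
  then show ?thesis
    unfolding angles edge_curvature_integral_def by (simp add: integral_unique algebra_simps)
qed

end

section \<open>Vector calculus in space\<close>

lemma bounded_bilinear_cross3: "bounded_bilinear cross3"
  using bilinear_cross bilinear_conv_bounded_bilinear by blast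

lemmas cross3_has_vector_derivative = bounded_bilinear.has_vector_derivative[OF bounded_bilinear_cross3]

lemmas inner_has_vector_derivative = bounded_bilinear.has_vector_derivative[OF bounded_bilinear_inner]

lemmas scaleR_has_vector_derivative = bounded_bilinear.has_vector_derivative[OF bounded_bilinear_scaleR]

lemma inner_derivative_of_const:
  fixes f g :: "real \<Rightarrow> 'a::real_inner"
  assumes "\<And>t. f t \<bullet> g t = k" "(f has_vector_derivative f1) (at t)" "(g has_vector_derivative g1) (at t)"
  shows "f t \<bullet> g1 + f1 \<bullet> g t = 0"
  using inner_has_vector_derivative[OF assms(2,3)] vector_derivative_at unfolding assms(1) by fastforce

text \<open>The three vectors lie in one plane. Expanding the nested product
  \<open>z \<times> (n \<times> (x \<times> y))\<close> leaves the triple product times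
  \<open>n\<close>, while its inner factor vanishes.\<close>

lemma triple_product_eq_0:
  assumes "n \<noteq> 0" "n \<bullet> x = 0" "n \<bullet> y = 0" "n \<bullet> z = 0"
  shows "cross3 x y \<bullet> z = 0"
proof -
  have "cross3 n (cross3 x y) = 0"
    using assms by (simp add: Lagrange)
  moreover have "(z \<bullet> cross3 x y) *\<^sub>R n = cross3 z (cross3 n (cross3 x y))"
    unfolding Lagrange[of z] using assms by (simp add: inner_commute)
  ultimately have "z \<bullet> cross3 x y = 0"
    using assms(1) by simp
  then show ?thesis
    by (simp add: inner_commute)
qed

text \<open>The residual \<open>z\<close> is orthogonal to \<open>u\<close>, \<open>v\<close> and
  \<open>n\<close>. It has zero cross product and zero inner product with the unit vector
  \<open>cross3 u v\<close>, hence vanishes.\<close>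

lemma orthonormal_expansion:
  fixes x :: "real^3"
  assumes "u \<bullet> u = 1" "v \<bullet> v = 1" "u \<bullet> v = 0" "n \<noteq> 0" "n \<bullet> u = 0" "n \<bullet> v = 0" "n \<bullet> x = 0"
  shows "x = (x \<bullet> u) *\<^sub>R u + (x \<bullet> v) *\<^sub>R v"
proof -
  define z where "z = x - (x \<bullet> u) *\<^sub>R u - (x \<bullet> v) *\<^sub>R v"
  have z: "z \<bullet> u = 0" "z \<bullet> v = 0" "n \<bullet> z = 0"
    using assms by (simp_all add: z_def inner_diff_left inner_diff_right inner_commute[of v u])
  then have "cross3 z (cross3 u v) = 0"
    by (simp add: Lagrange)
  moreover have "z \<bullet> cross3 u v = 0"
    using triple_product_eq_0[of n u v z] assms z by (simp add: inner_commute)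
  moreover have "cross3 u v \<bullet> cross3 u v = 1"
    using assms by (simp add: dot_cross inner_commute[of v u])
  ultimately have "z = 0"
    using norm_and_cross_eq_0[of z "cross3 u v"] by auto
  then show ?thesis
    by (simp add: z_def algebra_simps)
qed

section \<open>Smoothness under translation and change of sign\<close>

lemma Ck_on_translate:
  fixes f :: "'a::euclidean_space \<Rightarrow> 'b::real_normed_vector"
  shows "Ck_on k UNIV f \<Longrightarrow> Ck_on k U (\<lambda>x. f (t + x))"
proof (induction k arbitrary: f)
  case 0
  then show ?case
    by (auto intro!: continuous_intros continuous_on_compose2[of UNIV f])
next
  case (Suc k)
  have d: "((\<lambda>x. f (t + x)) has_derivative frechet_derivative f (at (t + x))) (at x)" for x
  proof -
    have "((\<lambda>x. t + x) has_derivative (\<lambda>x. x)) (at x)"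
      by (auto intro!: derivative_eq_intros)
    moreover have "(f has_derivative frechet_derivative f (at (t + x))) (at (t + x))"
      using Suc.prems by (simp add: frechet_derivative_works)
    ultimately show ?thesis
      by (rule has_derivative_compose)
  qed
  then have "frechet_derivative (\<lambda>x. f (t + x)) (at x) = frechet_derivative f (at (t + x))" for x
    by (rule frechet_derivative_at[symmetric])
  then show ?case
    using Suc.prems Suc.IH[of "\<lambda>x. frechet_derivative f (at x) v" for v] d
    by (auto simp: differentiable_def)
qed

lemma Ck_on_minus:
  fixes f :: "'a::euclidean_space \<Rightarrow> 'b::real_normed_vector"
  shows "Ck_on k UNIV f \<Longrightarrow> Ck_on k UNIV (\<lambda>x. - f x)"
proof (induction k arbitrary: f)
  case 0
  then show ?case
    by (auto intro: continuous_intros)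
next
  case (Suc k)
  have d: "((\<lambda>x. - f x) has_derivative (\<lambda>v. - frechet_derivative f (at x) v)) (at x)" for x
    using Suc.prems by (auto intro!: derivative_intros simp: frechet_derivative_works[symmetric])
  then have "frechet_derivative (\<lambda>x. - f x) (at x) = (\<lambda>v. - frechet_derivative f (at x) v)" for x
    by (rule frechet_derivative_at[symmetric])
  moreover have "Ck_on k UNIV (\<lambda>x. - frechet_derivative f (at x) v)" for v
    using Suc by simp
  ultimately show ?case
    using d by (auto simp: differentiable_def)
qed

lemma piecewise_smooth_minus:
  assumes "piecewise_smooth w"
  shows "piecewise_smooth (\<lambda>t. - w t)"
proof -
  have "\<exists>g'. smooth_on UNIV g' \<and> (\<forall>t\<in>A. - w t = g' t)"
    if "\<exists>g. smooth_on UNIV g \<and> (\<forall>t\<in>A. w t = g t)" for A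
  proof -
    from that obtain g where "smooth_on UNIV g" "\<forall>t\<in>A. w t = g t" by blast
    then show ?thesis
      by (intro exI[of _ "\<lambda>t. - g t"]) (auto simp: smooth_on_def intro: Ck_on_minus)
  qed
  with assms show ?thesis
    unfolding piecewise_smooth_def by (elim ex_forward conjE) simp
qed

text \<open>\<open>tangent_space\<close> asks for curves through the point at parameter 0, so the
  curve is translated by \<open>t\<close> and restricted.\<close>

lemma velocity_in_tangent_space:
  assumes "smooth_on UNIV \<gamma>" "\<And>t. \<gamma> t \<in> S" "(\<gamma> has_vector_derivative v) (at t)"
  shows "v \<in> tangent_space S (\<gamma> t)"
proof -
  have "((\<lambda>s. \<gamma> (t + s)) has_vector_derivative v) (at 0)"
  proof -
    have "((\<lambda>s. t + s) has_vector_derivative 1) (at 0)"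
      by (auto intro!: derivative_eq_intros)
    from vector_diff_chain_at[OF this, of \<gamma> v] show ?thesis
      using assms(3) by (simp add: o_def)
  qed
  moreover have "smooth_on {-1<..<1} (\<lambda>s. \<gamma> (t + s))"
    using assms(1) Ck_on_translate unfolding smooth_on_def by blast
  ultimately show ?thesis
    unfolding tangent_space_def using assms(2)
    by (intro CollectI exI[of _ "\<lambda>s. \<gamma> (t + s)"] exI[of _ 1]) auto
qed

section \<open>Normalized vector fields, and shifts of one-sided derivatives\<close>

lemma inverse_norm_has_real_derivative:
  fixes Q :: "real \<Rightarrow> 'a::real_inner"
  assumes "(Q has_vector_derivative Q1) (at t)" "Q t \<noteq> 0"
  shows "((\<lambda>t. inverse (norm (Q t))) has_real_derivative - (Q t \<bullet> Q1) * inverse (norm (Q t)) ^ 3) (at t)"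
proof -
  have "((\<lambda>t. Q t \<bullet> Q t) has_real_derivative 2 * (Q t \<bullet> Q1)) (at t)"
    using inner_has_vector_derivative[OF assms(1) assms(1)]
    by (simp add: has_real_derivative_iff_has_vector_derivative inner_commute)
  then show ?thesis
    unfolding norm_eq_sqrt_inner using assms(2) inner_ge_zero[of "Q t", THEN leD]
    by (auto intro!: derivative_eq_intros simp: power_inverse field_simps power3_eq_cube)
qed

lemma normalized_has_vector_derivative:
  fixes Q :: "real \<Rightarrow> 'a::real_inner"
  assumes "(Q has_vector_derivative Q1) (at t)" "Q t \<noteq> 0"
  shows "((\<lambda>t. Q t /\<^sub>R norm (Q t)) has_vector_derivative
    inverse (norm (Q t)) *\<^sub>R Q1 + (- (Q t \<bullet> Q1) * inverse (norm (Q t)) ^ 3) *\<^sub>R Q t) (at t)"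
  using inverse_norm_has_real_derivative[OF assms]
  by (intro scaleR_has_vector_derivative assms(1)) (simp add: has_real_derivative_iff_has_vector_derivative)

text \<open>Serves to differentiate the director twice: the rotation rate \<open>\<omega>\<close>
  contains its first derivative and must itself be differentiable.\<close>

lemma normalized_derivative_differentiable:
  fixes Q :: "real \<Rightarrow> 'a::real_inner"
  assumes Q: "(Q has_vector_derivative Q1 t) (at t)" "(Q1 has_vector_derivative Q2) (at t)" "Q t \<noteq> 0"
  shows "(\<lambda>t. inverse (norm (Q t)) *\<^sub>R Q1 t + (- (Q t \<bullet> Q1 t) * inverse (norm (Q t)) ^ 3) *\<^sub>R Q t)
    differentiable (at t)"
proof -
  note i = inverse_norm_has_real_derivative[OF Q(1,3)]
  have "((\<lambda>t. Q t \<bullet> Q1 t) has_real_derivative (Q t \<bullet> Q2 + Q1 t \<bullet> Q1 t)) (at t)"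
    using inner_has_vector_derivative[OF Q(1,2)]
    by (simp add: has_real_derivative_iff_has_vector_derivative)
  from DERIV_mult[OF DERIV_minus[OF this] DERIV_power[OF i, of 3]] obtain D where "((\<lambda>t. - (Q t \<bullet> Q1 t) * inverse (norm (Q t)) ^ 3) has_real_derivative D) (at t)"
    by blast
  note D = this[unfolded has_real_derivative_iff_has_vector_derivative]
  note i = i[unfolded has_real_derivative_iff_has_vector_derivative]
  show ?thesis
    by (rule differentiableI_vector has_vector_derivative_add scaleR_has_vector_derivative i Q D)+
qed

text \<open>Both sides choose from the same set of derivatives, so the equation holds even where no
  derivative exists.\<close>

lemma vector_derivative_at_left_shift:
  fixes c :: "real \<Rightarrow> 'a::real_normed_vector"
  shows "vector_derivative c (at_left (t + T)) = vector_derivative (\<lambda>s. c (s + T)) (at_left t)"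
proof -
  have shift: "((\<lambda>s. h (s + r)) has_vector_derivative v) (at_left x)"
    if "(h has_vector_derivative v) (at_left (x + r))" for h :: "real \<Rightarrow> 'a" and v x r
  proof -
    have "(\<lambda>s. s + r) ` {..<x} = {..<x + r}"
      by (auto simp: image_iff intro!: bexI[of _ "_ - r"])
    moreover have "((\<lambda>s. s + r) has_vector_derivative 1) (at_left x)"
      by (auto intro!: derivative_eq_intros)
    ultimately show ?thesis
      using vector_diff_chain_within[of "\<lambda>s. s + r" 1 x "{..<x}" h v] that by (simp add: o_def)
  qed
  have "(c has_vector_derivative v) (at_left (t + T)) \<longleftrightarrow> ((\<lambda>s. c (s + T)) has_vector_derivative v) (at_left t)" for v
    using shift[of c v t T] shift[of "\<lambda>s. c (s + T)" v "t + T" "- T"] by auto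
  then show ?thesis
    unfolding vector_derivative_def by simp
qed

section \<open>The surface normal and the rulings\<close>

text \<open>Three derivatives of \<open>N\<close> are provided because the director is a normalized
  multiple of \<open>cross3 (N t) (N1 t)\<close> and is differentiated twice.\<close>

lemma regular_curve_derivatives:
  assumes "regular_curve_on S \<gamma> N"
  obtains \<gamma>1 \<gamma>2 N1 N2 N3 where
    "\<And>t. (\<gamma> has_vector_derivative \<gamma>1 t) (at t)" "\<And>t. (\<gamma>1 has_vector_derivative \<gamma>2 t) (at t)"
    "\<And>t. (N has_vector_derivative N1 t) (at t)" "\<And>t. (N1 has_vector_derivative N2 t) (at t)"
    "\<And>t. (N2 has_vector_derivative N3 t) (at t)"
proof -
  have "smooth_on UNIV \<gamma>" "smooth_on UNIV N"
    using assms by (auto simp: regular_curve_on_def)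
  then show ?thesis
    using that by (metis smooth_on_real_deriv)
qed

text \<open>The Weingarten equation \<open>N' = - \<parallel>\<gamma>'\<parallel> (\<kappa>\<^sub>n e + \<tau>\<^sub>g h)\<close>, rotated by a right angle in the
  tangent plane: the rulings of the ribbon are orthogonal to \<open>N'\<close>.\<close>

lemma cross3_normal_derivative:
  assumes reg: "regular_curve_on S \<gamma> N"
    and \<gamma>: "\<And>t. (\<gamma> has_vector_derivative \<gamma>1 t) (at t)" "\<And>t. (\<gamma>1 has_vector_derivative \<gamma>2 t) (at t)"
    and N: "\<And>t. (N has_vector_derivative N1 t) (at t)"
  shows "N t \<bullet> \<gamma>1 t = 0" "N t \<bullet> N1 t = 0"
    and "cross3 (N t) (N1 t) = - (norm (\<gamma>1 t) *\<^sub>R director_numerator \<gamma> N t)"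
proof -
  have vel: "velocity \<gamma> s = \<gamma>1 s" for s
    by (rule vector_derivative_at[OF \<gamma>(1)])
  have nz: "\<gamma>1 s \<noteq> 0" and NN: "N s \<bullet> N s = 1" for s
    using reg vel by (auto simp: regular_curve_on_def norm_eq_1)
  show N\<gamma>: "N s \<bullet> \<gamma>1 s = 0" for s
    using reg velocity_in_tangent_space[OF _ _ \<gamma>(1), of S s] by (auto simp: regular_curve_on_def)
  show NN1: "N t \<bullet> N1 t = 0"
    using inner_derivative_of_const[OF NN N N, of t] by (simp add: inner_commute)
  define e where "e s = \<gamma>1 s /\<^sub>R norm (\<gamma>1 s)" for s
  define h where "h s = cross3 (N s) (e s)" for s
  have ut: "unit_tangent \<gamma> = e" and dh: "darboux_h \<gamma> N = h"
    unfolding unit_tangent_def[abs_def] darboux_h_def[abs_def] by (simp_all add: fun_eq_iff vel e_def h_def)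
  obtain e1 where e1: "(e has_vector_derivative e1) (at t)"
    unfolding e_def[abs_def] using normalized_has_vector_derivative[OF \<gamma>(2) nz] by blast
  obtain h1 where h1: "(h has_vector_derivative h1) (at t)"
    unfolding h_def[abs_def] using cross3_has_vector_derivative[OF N e1] by blast
  have Ne: "N s \<bullet> e s = 0" and Nh: "N s \<bullet> h s = 0" for s
    by (simp_all add: e_def h_def N\<gamma> dot_cross_self)
  \<comment> \<open>Differentiating \<open>N \<bullet> e = 0\<close> and
    \<open>N \<bullet> h = 0\<close> moves the derivative onto \<open>N\<close>, so that
    \<open>\<kappa>\<^sub>n\<close> and \<open>\<tau>\<^sub>g\<close> become components of
    \<open>N1\<close>.\<close>
  have "N t \<bullet> e1 + N1 t \<bullet> e t = 0" "N t \<bullet> h1 + N1 t \<bullet> h t = 0"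
    by (rule inner_derivative_of_const[OF Ne N e1] inner_derivative_of_const[OF Nh N h1])+
  moreover have "normal_curvature \<gamma> N t * norm (\<gamma>1 t) = e1 \<bullet> N t"
    "geodesic_torsion \<gamma> N t * norm (\<gamma>1 t) = h1 \<bullet> N t"
    unfolding normal_curvature_def geodesic_torsion_def ut dh vel
      vector_derivative_at[OF e1] vector_derivative_at[OF h1] using nz by simp_all
  ultimately have comp: "N1 t \<bullet> e t = - (normal_curvature \<gamma> N t * norm (\<gamma>1 t))"
    "N1 t \<bullet> h t = - (geodesic_torsion \<gamma> N t * norm (\<gamma>1 t))"
    by (simp_all add: inner_commute)
  have ee: "e t \<bullet> e t = 1"
    unfolding e_def using nz by (simp add: dot_square_norm power2_eq_square)
  then have hh: "h t \<bullet> h t = 1"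
    unfolding h_def dot_cross by (simp add: NN Ne inner_commute[of "e t" "N t"])
  have "N1 t = (N1 t \<bullet> e t) *\<^sub>R e t + (N1 t \<bullet> h t) *\<^sub>R h t"
  proof (rule orthonormal_expansion[OF ee hh])
    show "e t \<bullet> h t = 0" by (simp add: h_def dot_cross_self)
    show "N t \<noteq> 0" using NN[of t] by auto
  qed (use Ne Nh NN1 in auto)
  moreover have "cross3 (N t) (h t) = - e t"
    unfolding h_def Lagrange by (simp add: Ne NN)
  ultimately have "cross3 (N t) (N1 t) = (N1 t \<bullet> e t) *\<^sub>R h t - (N1 t \<bullet> h t) *\<^sub>R e t"
    by (metis (no_types) cross_add_right cross_mult_right h_def scaleR_minus_right diff_conv_add_uminus)
  then show "cross3 (N t) (N1 t) = - (norm (\<gamma>1 t) *\<^sub>R director_numerator \<gamma> N t)"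
    unfolding comp director_numerator_def ut dh by (simp add: algebra_simps)
qed

text \<open>Pythagoras in the orthonormal pair \<open>e\<close>, \<open>h\<close>; in particular the
  numerator vanishes wherever the denominator does.\<close>

lemma norm_director_numerator:
  assumes "regular_curve_on S \<gamma> N"
  shows "norm (director_numerator \<gamma> N t) = director_denominator \<gamma> N t"
proof -
  obtain \<gamma>1 \<gamma>2 N1 N2 N3 where d: "\<And>t. (\<gamma> has_vector_derivative \<gamma>1 t) (at t)"
    "\<And>t. (\<gamma>1 has_vector_derivative \<gamma>2 t) (at t)" "\<And>t. (N has_vector_derivative N1 t) (at t)"
    using regular_curve_derivatives[OF assms] by metis
  let ?e = "unit_tangent \<gamma> t" and ?h = "darboux_h \<gamma> N t"
  have "velocity \<gamma> t = \<gamma>1 t"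
    by (rule vector_derivative_at[OF d(1)])
  moreover from this have "\<gamma>1 t \<noteq> 0"
    using assms by (metis regular_curve_on_def)
  ultimately have e: "?e \<bullet> ?e = 1" "N t \<bullet> ?e = 0"
    using cross3_normal_derivative(1)[OF assms d, of t]
    by (simp_all add: unit_tangent_def dot_square_norm power2_eq_square)
  moreover have "N t \<bullet> N t = 1"
    using assms by (simp add: regular_curve_on_def norm_eq_1)
  ultimately have "?h \<bullet> ?h = 1" "?h \<bullet> ?e = 0"
    unfolding darboux_h_def dot_cross by (simp_all add: inner_commute[of ?e "N t"] dot_cross_self)
  with e(1) show ?thesis
    unfolding director_denominator_def norm_eq_sqrt_inner director_numerator_def
    by (simp add: inner_diff_left inner_diff_right inner_commute[of ?e ?h] power2_eq_square)
qed

text \<open>The director numerator is parallel to \<open>cross3 (N t) (N1 t)\<close>, which is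
  orthogonal to \<open>N1 t\<close>. Where the denominator vanishes \<open>v\<close> is arbitrary,
  but there \<open>N1 t\<close> is both parallel and orthogonal to \<open>N t\<close> and so
  zero.\<close>

lemma director_orthogonal_normal_derivative:
  assumes reg: "regular_curve_on S \<gamma> N"
    and N: "\<And>t. (N has_vector_derivative N1 t) (at t)"
    and \<beta>: "director_denominator \<gamma> N t *\<^sub>R v = director_numerator \<gamma> N t \<or>
      director_denominator \<gamma> N t *\<^sub>R v = - director_numerator \<gamma> N t"
  shows "N1 t \<bullet> v = 0"
proof -
  obtain \<gamma>1 \<gamma>2 where \<gamma>: "\<And>t. (\<gamma> has_vector_derivative \<gamma>1 t) (at t)"
    "\<And>t. (\<gamma>1 has_vector_derivative \<gamma>2 t) (at t)"
    using regular_curve_derivatives[OF reg] by metis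
  note N' = cross3_normal_derivative(2,3)[OF reg \<gamma> N, of t]
  have "velocity \<gamma> t = \<gamma>1 t"
    by (rule vector_derivative_at[OF \<gamma>(1)])
  then have nz: "\<gamma>1 t \<noteq> 0"
    using reg by (metis regular_curve_on_def)
  show ?thesis
  proof (cases "director_denominator \<gamma> N t = 0")
    case True
    then have "cross3 (N t) (N1 t) = 0"
      using N'(2) norm_director_numerator[OF reg, of t] by simp
    moreover have "N t \<noteq> 0"
      using reg by (metis norm_zero regular_curve_on_def zero_neq_one)
    ultimately have "N1 t = 0"
      using N'(1) norm_and_cross_eq_0 by blast
    then show ?thesis by simp
  next
    case False
    have "N1 t \<bullet> (norm (\<gamma>1 t) *\<^sub>R director_numerator \<gamma> N t) = - (N1 t \<bullet> cross3 (N t) (N1 t))"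
      unfolding N'(2) by simp
    then have "N1 t \<bullet> director_numerator \<gamma> N t = 0"
      using nz by (simp add: dot_cross_self)
    then have "N1 t \<bullet> (director_denominator \<gamma> N t *\<^sub>R v) = 0"
      using \<beta> by (metis inner_minus_right neg_equal_0_iff_equal)
    then show ?thesis
      using False by simp
  qed
qed

text \<open>Rewriting the director as the normalization of \<open>- cross3 (N t) (N1 t)\<close>
  gives its derivatives without differentiating the two curvature functions;
  \<open>\<kappa>\<^sub>n \<noteq> 0\<close> keeps that vector away from zero.\<close>

lemma cartan_director:
  assumes reg: "regular_curve_on S \<gamma> N" and \<kappa>: "\<And>t. normal_curvature \<gamma> N t \<noteq> 0"
  defines "\<beta> \<equiv> cartan_director \<gamma> N"
  obtains \<beta>1 where "\<And>t. (\<beta> has_vector_derivative \<beta>1 t) (at t)" "\<And>t. \<beta>1 differentiable (at t)"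
    "\<And>t. norm (\<beta> t) = 1" "\<And>t. N t \<bullet> \<beta> t = 0"
    "\<And>t. director_denominator \<gamma> N t *\<^sub>R \<beta> t = director_numerator \<gamma> N t"
proof -
  obtain \<gamma>1 \<gamma>2 N1 N2 N3 where \<gamma>: "\<And>t. (\<gamma> has_vector_derivative \<gamma>1 t) (at t)"
    "\<And>t. (\<gamma>1 has_vector_derivative \<gamma>2 t) (at t)" and N: "\<And>t. (N has_vector_derivative N1 t) (at t)"
    "\<And>t. (N1 has_vector_derivative N2 t) (at t)" "\<And>t. (N2 has_vector_derivative N3 t) (at t)"
    using regular_curve_derivatives[OF reg] by metis
  define Q where "Q t = cross3 (N t) (N1 t)" for t
  have den: "norm (director_numerator \<gamma> N t) = director_denominator \<gamma> N t" for t
    by (rule norm_director_numerator[OF reg])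
  have den0: "director_denominator \<gamma> N t \<noteq> 0" for t
    using \<kappa>[of t] by (simp add: director_denominator_def sum_power2_eq_zero_iff)
  have "velocity \<gamma> t = \<gamma>1 t" for t
    by (rule vector_derivative_at[OF \<gamma>(1)])
  then have nz: "\<gamma>1 t \<noteq> 0" for t
    using reg by (metis regular_curve_on_def)
  have QN: "Q t = - (norm (\<gamma>1 t) *\<^sub>R director_numerator \<gamma> N t)" for t
    unfolding Q_def by (rule cross3_normal_derivative(3)[OF reg \<gamma> N(1)])
  have nQ: "norm (Q t) = norm (\<gamma>1 t) * director_denominator \<gamma> N t" for t
    by (simp add: QN den)
  have Q0: "Q t \<noteq> 0" for t
    using nQ[of t] nz[of t] den0[of t] by auto
  have \<beta>Q: "\<beta> t = - (Q t /\<^sub>R norm (Q t))" for t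
    unfolding \<beta>_def cartan_director_def nQ using nz[of t] by (simp add: QN)
  have Q1: "(Q has_vector_derivative cross3 (N t) (N2 t)) (at t)" for t
    using cross3_has_vector_derivative[OF N(1,2), of t] by (simp add: Q_def[abs_def])
  have Q2: "((\<lambda>t. cross3 (N t) (N2 t)) has_vector_derivative
      cross3 (N t) (N3 t) + cross3 (N1 t) (N2 t)) (at t)" for t
    by (rule cross3_has_vector_derivative[OF N(1,3)])
  show thesis
  proof (rule that)
    show "(\<beta> has_vector_derivative - (inverse (norm (Q t)) *\<^sub>R cross3 (N t) (N2 t) +
        (- (Q t \<bullet> cross3 (N t) (N2 t)) * inverse (norm (Q t)) ^ 3) *\<^sub>R Q t)) (at t)" for t
      using has_vector_derivative_minus[OF normalized_has_vector_derivative[OF Q1 Q0]]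
      unfolding \<beta>Q[abs_def] .
    show "(\<lambda>t. - (inverse (norm (Q t)) *\<^sub>R cross3 (N t) (N2 t) +
        (- (Q t \<bullet> cross3 (N t) (N2 t)) * inverse (norm (Q t)) ^ 3) *\<^sub>R Q t)) differentiable (at t)" for t
      by (rule differentiable_minus[OF normalized_derivative_differentiable[OF Q1 Q2 Q0]])
    show "norm (\<beta> t) = 1" for t
      unfolding \<beta>Q using Q0[of t] by simp
    show "N t \<bullet> \<beta> t = 0" for t
      unfolding \<beta>Q by (simp add: Q_def dot_cross_self)
    show "director_denominator \<gamma> N t *\<^sub>R \<beta> t = director_numerator \<gamma> N t" for t
      unfolding \<beta>_def cartan_director_def using den0 by simp
  qed
qed

section \<open>Closed developable ribbons\<close>

text \<open>Straight rulings make the coefficient \<open>Q\<close> of the second fundamental form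
  vanish, and the mixed coefficient \<open>M\<close> is a multiple of a triple product of vectors
  orthogonal to \<open>n\<close>.\<close>

lemma ruled_gauss_curvature_eq_0:
  assumes \<gamma>: "\<And>t. (\<gamma> has_vector_derivative \<gamma>1 t) (at t)"
    and \<beta>: "\<And>t. (\<beta> has_vector_derivative \<beta>1 t) (at t)"
    and perp: "n \<noteq> 0" "n \<bullet> \<gamma>1 t = 0" "n \<bullet> \<beta> t = 0" "n \<bullet> \<beta>1 t = 0"
  shows "gauss_curvature (ruled \<gamma> \<beta>) t u = 0"
proof -
  have lin: "((\<lambda>v. p + v *\<^sub>R q) has_vector_derivative q) (at v)" for p q :: "real^3" and v
    by (auto intro!: derivative_eq_intros)
  have 1: "par1 (ruled \<gamma> \<beta>) t v = \<gamma>1 t + v *\<^sub>R \<beta>1 t" for v t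
    unfolding par1_def ruled_def
    by (intro vector_derivative_at has_vector_derivative_add \<gamma>)
      (auto intro!: derivative_eq_intros \<beta>)
  have 2: "par2 (ruled \<gamma> \<beta>) t v = \<beta> t" for v
    unfolding par2_def ruled_def by (rule vector_derivative_at[OF lin])
  have 12: "par2 (par1 (ruled \<gamma> \<beta>)) t u = \<beta>1 t"
    unfolding par2_def 1 by (rule vector_derivative_at[OF lin])
  have 22: "par2 (par2 (ruled \<gamma> \<beta>)) t u = 0"
    unfolding par2_def[of "par2 _"] 2 by simp
  have "cross3 (\<gamma>1 t + u *\<^sub>R \<beta>1 t) (\<beta> t) \<bullet> \<beta>1 t = 0"
    using perp by (intro triple_product_eq_0[of n]) (auto simp: inner_add_right)
  then show ?thesis
    unfolding gauss_curvature_def Let_def 12 22 1 2 by (simp add: inner_commute)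
qed

text \<open>Gram-Schmidt applied to \<open>\<beta>\<close> and the velocity
  \<open>\<gamma>1\<close>; regularity makes \<open>p\<close> nonzero. As \<open>\<beta>1\<close> is
  orthogonal to \<open>n\<close> and to the unit field \<open>\<beta>\<close>, it is a multiple of
  \<open>f\<close>.\<close>

lemma flat_strip_of_ruled:
  fixes \<gamma> \<beta> :: "real \<Rightarrow> real^3"
  assumes \<gamma>: "\<And>t. (\<gamma> has_vector_derivative \<gamma>1 t) (at t)" "\<And>t. (\<gamma>1 has_vector_derivative \<gamma>2 t) (at t)"
    and \<beta>: "\<And>t. (\<beta> has_vector_derivative \<beta>1 t) (at t)" "\<And>t. \<beta>1 differentiable (at t)" "\<And>t. norm (\<beta> t) = 1"
    and n: "\<And>t. n t \<noteq> 0" "\<And>t. n t \<bullet> \<gamma>1 t = 0" "\<And>t. n t \<bullet> \<beta> t = 0" "\<And>t. n t \<bullet> \<beta>1 t = 0"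
    and reg: "\<And>t. cross3 (\<gamma>1 t) (\<beta> t) \<noteq> 0"
  defines "p \<equiv> \<lambda>t. \<gamma>1 t - (\<gamma>1 t \<bullet> \<beta> t) *\<^sub>R \<beta> t"
  defines "f \<equiv> \<lambda>t. p t /\<^sub>R norm (p t)"
  shows "flat_strip \<gamma> \<beta> f (\<lambda>t. \<gamma>1 t \<bullet> \<beta> t) (\<lambda>t. \<gamma>1 t \<bullet> f t) (\<lambda>t. \<beta>1 t \<bullet> f t)"
    and "\<gamma>1 t = (\<gamma>1 t \<bullet> \<beta> t) *\<^sub>R \<beta> t + (\<gamma>1 t \<bullet> f t) *\<^sub>R f t" "\<beta>1 t = (\<beta>1 t \<bullet> f t) *\<^sub>R f t"
    and "\<gamma>1 t \<bullet> f t > 0"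
proof -
  have \<beta>\<beta>: "\<beta> t \<bullet> \<beta> t = 1" for t
    using \<beta>(3) by (simp add: norm_eq_1)
  have p0: "p t \<noteq> 0" for t
  proof
    assume "p t = 0"
    then have "cross3 (\<gamma>1 t) (\<beta> t) = cross3 ((\<gamma>1 t \<bullet> \<beta> t) *\<^sub>R \<beta> t) (\<beta> t)"
      by (simp add: p_def)
    then show False
      using reg[of t] by (simp add: cross_mult_left)
  qed
  have ff: "f t \<bullet> f t = 1" for t
    unfolding f_def using p0[of t] by (simp add: dot_square_norm power2_eq_square)
  have \<beta>f: "\<beta> t \<bullet> f t = 0" for t
    by (simp add: f_def p_def inner_diff_right inner_commute \<beta>\<beta>)
  have nf: "n t \<bullet> f t = 0" for t
    using n by (simp add: f_def p_def inner_diff_right)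
  have expand: "x = (x \<bullet> \<beta> t) *\<^sub>R \<beta> t + (x \<bullet> f t) *\<^sub>R f t" if "n t \<bullet> x = 0" for x t
    using \<beta>\<beta> ff \<beta>f n nf that by (intro orthonormal_expansion[of _ _ "n t"]) auto
  show \<gamma>1: "\<gamma>1 t = (\<gamma>1 t \<bullet> \<beta> t) *\<^sub>R \<beta> t + (\<gamma>1 t \<bullet> f t) *\<^sub>R f t" for t
    by (rule expand[OF n(2)])
  have "\<beta> t \<bullet> \<beta>1 t = 0" for t
    using inner_derivative_of_const[OF \<beta>\<beta> \<beta>(1) \<beta>(1), of t] by (simp add: inner_commute)
  then show \<beta>1: "\<beta>1 t = (\<beta>1 t \<bullet> f t) *\<^sub>R f t" for t
    using expand[OF n(4), of t] by (simp add: inner_commute)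
  have "p t = norm (p t) *\<^sub>R f t" for t
    using p0[of t] by (simp add: f_def)
  then have "\<gamma>1 t \<bullet> f t = (norm (p t) *\<^sub>R f t + (\<gamma>1 t \<bullet> \<beta> t) *\<^sub>R \<beta> t) \<bullet> f t" for t
    by (metis diff_add_cancel p_def)
  then show "\<gamma>1 t \<bullet> f t > 0" for t
    using p0[of t] by (simp add: inner_add_left ff \<beta>f)
  have inner_diff: "(\<lambda>t. g t \<bullet> h t) differentiable (at t)"
    if "g differentiable (at t)" "h differentiable (at t)" for g h :: "real \<Rightarrow> real^3" and t
    by (rule differentiableI_vector[OF inner_has_vector_derivative[OF that[unfolded vector_derivative_works]]])
  have \<gamma>1_diff: "\<gamma>1 differentiable (at t)" and \<beta>_diff: "\<beta> differentiable (at t)" for t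
    using \<gamma> \<beta> differentiableI_vector by blast+
  have "p differentiable (at t)" for t
    unfolding p_def by (intro differentiable_diff differentiable_scaleR inner_diff \<gamma>1_diff \<beta>_diff)
  then have f_diff: "f differentiable (at t)" for t
    unfolding f_def
    using normalized_has_vector_derivative[of p] p0 by (meson differentiableI_vector vector_derivative_works)
  show "flat_strip \<gamma> \<beta> f (\<lambda>t. \<gamma>1 t \<bullet> \<beta> t) (\<lambda>t. \<gamma>1 t \<bullet> f t) (\<lambda>t. \<beta>1 t \<bullet> f t)"
    by unfold_locales
      (use \<gamma>(1) \<beta>(1) \<gamma>1 \<beta>1 f_diff inner_diff \<gamma>1_diff \<beta>_diff \<beta>(2) \<beta>\<beta> ff \<beta>f in auto)
qed

lemma closed_developable_ribbon:
  fixes \<gamma> \<beta> n :: "real \<Rightarrow> real^3"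
  assumes \<gamma>: "\<And>t. (\<gamma> has_vector_derivative \<gamma>1 t) (at t)" "\<And>t. (\<gamma>1 has_vector_derivative \<gamma>2 t) (at t)"
    and \<beta>: "\<And>t. (\<beta> has_vector_derivative \<beta>1 t) (at t)" "\<And>t. \<beta>1 differentiable (at t)" "\<And>t. norm (\<beta> t) = 1"
    and n: "\<And>t. n t \<noteq> 0" "\<And>t. n t \<bullet> \<gamma>1 t = 0" "\<And>t. n t \<bullet> \<beta> t = 0" "\<And>t. n t \<bullet> \<beta>1 t = 0"
    and reg: "regular_ribbon \<gamma> \<beta> wm wp" and "T > 0"
    and closed: "\<And>t. \<gamma> (t + T) = \<gamma> t"
    and glue: "(\<forall>t. \<beta> (t + T) = \<beta> t \<and> wp (t + T) = wp t \<and> wm (t + T) = wm t) \<or>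
      (\<forall>t. \<beta> (t + T) = - \<beta> t \<and> wp (t + T) = wm t \<and> wm (t + T) = wp t)"
  shows "ribbon_curvature_integral \<gamma> \<beta> wm wp T + boundary_curvature_integral \<gamma> \<beta> wm wp T
           + boundary_angle_sum \<gamma> \<beta> wm wp T = 0"
proof -
  have par: "cross3 (\<gamma>1 t + u *\<^sub>R \<beta>1 t) (\<beta> t) \<noteq> 0" if "u \<in> {- wm t..wp t}" for t u
  proof -
    have "par1 (ruled \<gamma> \<beta>) t u = \<gamma>1 t + u *\<^sub>R \<beta>1 t"
      unfolding par1_def ruled_def
      by (intro vector_derivative_at has_vector_derivative_add \<gamma>)
        (auto intro!: derivative_eq_intros \<beta>)
    moreover have "par2 (ruled \<gamma> \<beta>) t u = \<beta> t"
      unfolding par2_def ruled_def by (rule vector_derivative_at) (auto intro!: derivative_eq_intros)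
    ultimately show ?thesis
      using reg that by (metis regular_ribbon_def)
  qed
  have w: "wm t > 0" "wp t > 0" "piecewise_smooth wm" "piecewise_smooth wp" for t
    using reg by (auto simp: regular_ribbon_def)
  have par0: "cross3 (\<gamma>1 t) (\<beta> t) \<noteq> 0" for t
    using par[of 0 t] w(1,2)[of t] by simp
  define p where "p t = \<gamma>1 t - (\<gamma>1 t \<bullet> \<beta> t) *\<^sub>R \<beta> t" for t
  define f where "f t = p t /\<^sub>R norm (p t)" for t
  define a b \<omega> where "a t = \<gamma>1 t \<bullet> \<beta> t" and "b t = \<gamma>1 t \<bullet> f t" and "\<omega> t = \<beta>1 t \<bullet> f t" for t
  note strip = flat_strip_of_ruled[OF \<gamma> \<beta> n par0, folded p_def, folded f_def, folded a_def b_def \<omega>_def]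
  interpret flat_strip \<gamma> \<beta> f a b \<omega>
    using strip(1) by (simp add: a_def[abs_def] b_def[abs_def] \<omega>_def[abs_def])
  \<comment> \<open>An affine function of \<open>u\<close> that is positive at 0 and not at
    \<open>u\<close> has a zero \<open>v\<close> between them, at the fraction \<open>r\<close> of
    the way. There the two partial derivatives would both be multiples of \<open>\<beta> t\<close>,
    against regularity.\<close>
  have pos: "b t + u * \<omega> t > 0" if u: "u \<in> {- wm t..wp t}" for t u
  proof (rule ccontr)
    assume neg: "\<not> b t + u * \<omega> t > 0"
    have "b t > 0" by (rule strip(4))
    with neg have "u * \<omega> t \<noteq> 0" by auto
    then have \<omega>0: "\<omega> t \<noteq> 0" and u0: "u \<noteq> 0" by auto
    define v where "v = - (b t / \<omega> t)"
    have v\<omega>: "b t + v * \<omega> t = 0"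
      using \<omega>0 by (simp add: v_def)
    define r where "r = b t / - (u * \<omega> t)"
    have "0 \<le> r" "r \<le> 1" "v = r * u"
      using neg \<open>b t > 0\<close> \<omega>0 u0 by (auto simp: r_def v_def field_simps)
    then have "v \<in> closed_segment 0 u"
      by (auto simp: in_segment)
    moreover have "closed_segment 0 u \<subseteq> {- wm t..wp t}"
      using u w(1,2)[of t] by (auto simp: closed_segment_eq_real_ivl)
    ultimately have "v \<in> {- wm t..wp t}"
      by blast
    moreover have "\<gamma>1 t + v *\<^sub>R \<beta>1 t = a t *\<^sub>R \<beta> t + (b t + v * \<omega> t) *\<^sub>R f t"
      by (subst strip(2), subst strip(3)) (simp add: algebra_simps)
    ultimately show False
      using par[of v t] unfolding v\<omega> by (simp add: cross_mult_left)
  qed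

  let ?cp = "edge \<gamma> \<beta> wp" and ?cm = "edge \<gamma> \<beta> (\<lambda>t. - wm t)"
  have pos_edges: "b t + wp t * \<omega> t > 0" "b t + (- wm t) * \<omega> t > 0" for t
    by (rule pos; use w(1,2)[of t] in simp)+
  have "piecewise_smooth (\<lambda>t. - wm t)"
    by (rule piecewise_smooth_minus[OF w(3)])
  then have totals:
    "edge_curvature_integral ?cp (\<lambda>t. - \<beta> t) T + edge_angle_sum ?cp (\<lambda>t. - \<beta> t) T
      = - (left_slope ?cp T - left_slope ?cp 0 - integral {0..T} \<omega>)"
    "edge_curvature_integral ?cm \<beta> T + edge_angle_sum ?cm \<beta> T
      = left_slope ?cm T - left_slope ?cm 0 - integral {0..T} \<omega>"
    using edge_total[OF w(4) pos_edges(1), of "-1" T] edge_total[OF _ pos_edges(2), of 1 T] \<open>T > 0\<close>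
    by simp_all

  have "\<gamma>1 (t + T) = \<gamma>1 t" for t
  proof -
    have "((\<lambda>s. s + T) has_vector_derivative 1) (at t)"
      by (auto intro!: derivative_eq_intros)
    from vector_diff_chain_at[OF this \<gamma>(1)] have "(\<gamma> has_vector_derivative \<gamma>1 (t + T)) (at t)"
      by (simp add: o_def closed)
    then show ?thesis
      by (rule vector_derivative_unique_at[OF _ \<gamma>(1)])
  qed
  \<comment> \<open>\<open>p\<close> is even in \<open>\<beta>\<close>, so \<open>f\<close> stays
    the same when the ruling is reversed.\<close>
  then have f: "f (t + T) = f t" for t
    using glue by (auto simp: f_def p_def)
  have shift: "left_slope c T = slope_angle T (vector_derivative (\<lambda>s. c (s + T)) (at_left 0))" for c
    unfolding left_slope_def using vector_derivative_at_left_shift[of c 0 T] by simp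
  \<comment> \<open>The two totals carry opposite signs, so it is enough that the slopes of both
    edges change by the same amount over a period.\<close>
  have "left_slope ?cp T - left_slope ?cp 0 = left_slope ?cm T - left_slope ?cm 0"
    using glue
  proof
    assume *: "\<forall>t. \<beta> (t + T) = \<beta> t \<and> wp (t + T) = wp t \<and> wm (t + T) = wm t"
    then have "\<beta> T = \<beta> 0" "f T = f 0"
      using f[of 0] by (metis add_0)+
    then show ?thesis
      unfolding shift unfolding left_slope_def slope_angle_def using * closed
      by (simp add: edge_def[abs_def] ruled_def)
  next
    \<comment> \<open>Shifting by \<open>T\<close> exchanges the two edges, and the reversal of
      \<open>\<beta>\<close> changes the sign of every slope angle. Both differences equal minus the
      sum of the two left slopes at 0.\<close>
    assume *: "\<forall>t. \<beta> (t + T) = - \<beta> t \<and> wp (t + T) = wm t \<and> wm (t + T) = wp t"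
    then have "\<beta> T = - \<beta> 0" "f T = f 0"
      using f[of 0] by (metis add_0)+
    then show ?thesis
      unfolding shift unfolding left_slope_def slope_angle_def using * closed
      by (simp add: edge_def[abs_def] ruled_def arctan_minus)
  qed
  moreover have "ribbon_curvature_integral \<gamma> \<beta> wm wp T = 0"
    using ruled_gauss_curvature_eq_0[OF \<gamma>(1) \<beta>(1) n]
    by (simp add: ribbon_curvature_integral_def case_prod_unfold)
  ultimately show ?thesis
    using totals by (simp add: boundary_curvature_integral_def boundary_angle_sum_def)
qed

section \<open>Reduction of closed Cartan ribbons to developable ribbons\<close>

theorem lemma4p3:
  fixes S :: "(real^3) set" and \<gamma> N \<beta> :: "real \<Rightarrow> real^3" and wm wp :: "real \<Rightarrow> real" and T :: real
  assumes "cylindrical_cartan_ribbon S \<gamma> N \<beta> wm wp T \<or> moebius_cartan_ribbon S \<gamma> N \<beta> wm wp T"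
  shows "ribbon_curvature_integral \<gamma> \<beta> wm wp T + boundary_curvature_integral \<gamma> \<beta> wm wp T
           + boundary_angle_sum \<gamma> \<beta> wm wp T = 0"
proof -
  have reg: "regular_curve_on S \<gamma> N" "regular_ribbon \<gamma> \<beta> wm wp" "T > 0"
    using assms by (auto simp: cylindrical_cartan_ribbon_def moebius_cartan_ribbon_def
        cartan_ribbon_def extended_cartan_ribbon_def)
  obtain \<gamma>1 \<gamma>2 N1 where \<gamma>: "\<And>t. (\<gamma> has_vector_derivative \<gamma>1 t) (at t)"
    "\<And>t. (\<gamma>1 has_vector_derivative \<gamma>2 t) (at t)" and N: "\<And>t. (N has_vector_derivative N1 t) (at t)"
    using regular_curve_derivatives[OF reg(1)] by metis
  \<comment> \<open>Both types are brought to a common form. Differentiability of the ruling follows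
    from \<open>\<kappa>\<^sub>n \<noteq> 0\<close> for a cylinder and is part of the definition for
    a Moebius strip.\<close>
  have "\<exists>\<beta>1. (\<forall>t. (\<beta> has_vector_derivative \<beta>1 t) (at t)) \<and> (\<forall>t. \<beta>1 differentiable (at t)) \<and>
      (\<forall>t. norm (\<beta> t) = 1) \<and> (\<forall>t. N t \<bullet> \<beta> t = 0) \<and>
      (\<forall>t. director_denominator \<gamma> N t *\<^sub>R \<beta> t = director_numerator \<gamma> N t \<or>
          director_denominator \<gamma> N t *\<^sub>R \<beta> t = - director_numerator \<gamma> N t)"
    using assms
  proof
    assume "cylindrical_cartan_ribbon S \<gamma> N \<beta> wm wp T"
    then show ?thesis
      using cartan_director[OF reg(1)] unfolding cylindrical_cartan_ribbon_def cartan_ribbon_def by metis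
  next
    assume "moebius_cartan_ribbon S \<gamma> N \<beta> wm wp T"
    then have ext: "extended_cartan_ribbon S \<gamma> N \<beta> wm wp"
      by (simp add: moebius_cartan_ribbon_def)
    then have "smooth_on UNIV \<beta>"
      by (simp add: extended_cartan_ribbon_def)
    then obtain \<beta>1 where "\<forall>t. (\<beta> has_vector_derivative \<beta>1 t) (at t)" "\<forall>t. \<beta>1 differentiable (at t)"
      by (metis differentiableI_vector smooth_on_real_deriv)
    with ext show ?thesis
      unfolding extended_cartan_ribbon_def by blast
  qed
  then obtain \<beta>1 where \<beta>: "\<And>t. (\<beta> has_vector_derivative \<beta>1 t) (at t)" "\<And>t. \<beta>1 differentiable (at t)"
      "\<And>t. norm (\<beta> t) = 1" and N\<beta>: "\<And>t. N t \<bullet> \<beta> t = 0"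
    and num: "\<And>t. director_denominator \<gamma> N t *\<^sub>R \<beta> t = director_numerator \<gamma> N t \<or>
          director_denominator \<gamma> N t *\<^sub>R \<beta> t = - director_numerator \<gamma> N t"
    by metis
  \<comment> \<open>Here the choice of the director enters: as \<open>N1\<close> is orthogonal to
    \<open>\<beta>\<close>, the normal of \<open>S\<close> stays normal to the ribbon along each
    whole ruling.\<close>
  have "N t \<bullet> \<beta>1 t = 0" for t
    using inner_derivative_of_const[OF N\<beta> N \<beta>(1), of t]
      director_orthogonal_normal_derivative[OF reg(1) N num] by simp
  moreover have "N t \<noteq> 0" for t
    using reg(1) by (metis norm_zero regular_curve_on_def zero_neq_one)
  moreover note cross3_normal_derivative(1)[OF reg(1) \<gamma> N] N\<beta>
  moreover have closed: "\<gamma> (t + T) = \<gamma> t" for t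
  proof -
    have "ruled \<gamma> \<beta> (t + T) 0 = ruled \<gamma> \<beta> t 0"
      using assms by (auto simp: cylindrical_cartan_ribbon_def moebius_cartan_ribbon_def)
    then show ?thesis
      by (simp add: ruled_def)
  qed
  \<comment> \<open>The gluing holds for all real \<open>u\<close>, so it may be evaluated at
    \<open>u = 1\<close> whatever the widths are.\<close>
  moreover have "(\<forall>t. \<beta> (t + T) = \<beta> t \<and> wp (t + T) = wp t \<and> wm (t + T) = wm t) \<or>
      (\<forall>t. \<beta> (t + T) = - \<beta> t \<and> wp (t + T) = wm t \<and> wm (t + T) = wp t)"
    using assms
  proof
    assume c: "cylindrical_cartan_ribbon S \<gamma> N \<beta> wm wp T"
    then have "ruled \<gamma> \<beta> (t + T) 1 = ruled \<gamma> \<beta> t 1" for t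
      by (simp add: cylindrical_cartan_ribbon_def)
    then have "\<beta> (t + T) = \<beta> t" for t
      by (simp add: ruled_def closed)
    with c show ?thesis
      by (simp add: cylindrical_cartan_ribbon_def)
  next
    assume m: "moebius_cartan_ribbon S \<gamma> N \<beta> wm wp T"
    then have "ruled \<gamma> \<beta> (t + T) 1 = ruled \<gamma> \<beta> t (- 1)" for t
      by (simp add: moebius_cartan_ribbon_def)
    then have "\<beta> (t + T) = - \<beta> t" for t
      by (simp add: ruled_def closed)
    with m show ?thesis
      by (simp add: moebius_cartan_ribbon_def)
  qed
  ultimately show ?thesis
    using closed_developable_ribbon[OF \<gamma> \<beta> _ _ _ _ reg(2,3)] by blast
qed

end
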